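(* Consider the system $\dot x=f(x)+g(x)u$, $y=h(x)$ on the open set $U\subset\mathbb R^n$. Suppose that the system is regular and that the Jacobian $d\bar\Phi_{\rm d}(x)$ has full row rank for every $x\in U$ (Assumption $\mathcal B$). Let $q=\{q_1\le\dots\le q_{m_{\rm d}}\}$ be the integers obtained in the infinite zero structure algorithm. Then there exists a set of coordinates in $U$, i.e. a diffeomorphic state transformation $\mathrm{col}\{\eta,\xi\}=\Phi(x)$ on $U$, with $\eta\in\mathbb R^{n-n_{\rm d}}$, $\xi=\mathrm{col}\{\xi_1,\dots,\xi_{m_{\rm d}}\}$, $\xi_i=\mathrm{col}\{\xi_{i,1},\dots,\xi_{i,q_i}\}$, a smooth input transformation $\mathrm{col}\{u_{\rm e},u_{\rm d}\}=\Gamma_{\rm i}(x)u$ with $\Gamma_{\rm i}(x)\in\mathbb R^{m\times m}$ nonsingular on $U$ and $u_{\rm e}\in\mathbb R^{m-m_{\rm d}}$, and an output transformation $\mathrm{col}\{y_{\rm e},y_{\rm d}\}=\Gamma_{\rm o}y$ with $\Gamma_{\rm o}\in\mathbb R^{p\times p}$ constant and nonsingular and $y_{\rm d}\in\mathbb R^{m_{\rm d}}$, such that the system takes the form $$\begin{aligned} \dot\eta&=f_{\rm e}(x)+g_{\rm e}(x)u_{\rm e}+\sum_{l=1}^{m_{\rm d}}\varphi_l(x)v_{{\rm d},l},\\ \dot\xi_{i,j}&=\xi_{i,j+1}+\sum_{l=1}^{i-1}\delta_{i,j,l}(x)v_{{\rm d},l},\quad j=1,\dots,q_i-1,\\ \dot\xi_{i,q_i}&=v_{{\rm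 d},i},\\ y_{\rm e}&=h_{\rm e}(x),\qquad y_{{\rm d},i}=\xi_{i,1},\qquad i=1,\dots,m_{\rm d}, \end{aligned}$$ with smooth coefficient functions, where $v_{{\rm d},i}=a_i(x)+b_i(x)u$, $i=1,\dots,m_{\rm d}$, with $\mathrm{col}\{b_1(x),\dots,b_{m_{\rm d}}(x)\}$ of full row rank for $x\in U$, and $$\delta_{i,j,l}(x)=0\quad\text{for } j<q_l,\qquad i=1,\dots,m_{\rm d}.$$
   Context: System: $\dot x=f(x)+g(x)u$, $y=h(x)$, with $x\in\mathbb R^n$, $u\in\mathbb R^m$, $y\in\mathbb R^p$; $f,g,h$ are smooth on an open set $U\subset\mathbb R^n$ containing $0$, with $f(0)=0$, $h(0)=0$. For a smooth vector-valued $\Theta$, $d\Theta=\partial\Theta/\partial x$, $L_f\Theta=d\Theta\, f$, $L_g\Theta=d\Theta\, g$. $\mathrm{col}\{\cdot\}$ denotes vertical stacking. Matrices with zero rows are allowed (empty). Infinite zero structure algorithm. Initial step: $\Theta_0=h$, $\Omega_0=\emptyset$, $\rho_0=0$, $k=1$. Step $k$: given $\Theta_{k-1}:U\to\mathbb R^{p-\rho_{k-1}}$ and $\Omega_{k-1}:U\to\mathbb R^{\rho_{k-1}}$ with $L_g\Omega_{k-1}(x)$ of full row rank. Assumption $\mathcal A_k$: $\mathrm{col}\{L_g\Omega_{k-1}(x),L_g\Theta_{k-1}(x)\}$ has constant rank $\rho_k$ for $x\in U$, and there is a constant matrix $R_k\in\mathbb R^{(\rho_k-\rho_{k-1})\times(p-\rho_{k-1})}$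 such that $\mathrm{col}\{L_g\Omega_{k-1}(x),L_gR_k\Theta_{k-1}(x)\}$ has full row rank $\rho_k$ for $x\in U$. Choose a constant $S_k\in\mathbb R^{(p-\rho_k)\times(p-\rho_{k-1})}$ with $\mathrm{col}\{R_k,S_k\}$ nonsingular, and set $\Omega_k=\mathrm{col}\{R_1\Theta_0,R_2\Theta_1,\dots,R_k\Theta_{k-1}\}$. There are unique smooth matrix functions $P_{k,l}:U\to\mathbb R^{(p-\rho_k)\times(\rho_l-\rho_{l-1})}$, $l=1,\dots,k$, with $L_gS_k\Theta_{k-1}=\sum_{l=1}^kP_{k,l}L_gR_l\Theta_{l-1}$. Set $\Theta_k=L_fS_k\Theta_{k-1}-\sum_{l=1}^kP_{k,l}L_fR_l\Theta_{l-1}$. If $k+\sum_{j=1}^kj(\rho_j-\rho_{j-1})<n$ and $\rho_k<\min\{p,m\}$, increase $k$ by one and repeat; otherwise stop with $k^\star=k$. Put $m_{\rm d}=\rho_{k^\star}$, $n_{\rm d}=\sum_{j=1}^{k^\star}j(\rho_j-\rho_{j-1})$, and let $q=\{q_1\le\dots\le q_{m_{\rm d}}\}$ be the list in which each integer $j\in\{1,\dots,k^\star\}$ occurs $\rho_j-\rho_{j-1}$ times. The system is called regular if Assumptions $\mathcal A_k$, $k=1,\dots,k^\star$, are satisfied. Further notation: $S_{i\leftrightarrow j}=S_iS_{i-1}\cdots S_j$ (identity if $j>i$); $\zeta_{i,j}=R_iS_{i-1\leftrightarrow j}\Theta_{j-1}(x)$ for $1\le j\le i\le k^\star$; $\zeta_i=\mathrm{col}\{\zeta_{i,1},\dots,\zeta_{i,i}\}$;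 $\bar\Phi_{\rm d}(x)=\mathrm{col}\{\zeta_1,\dots,\zeta_{k^\star}\}\in\mathbb R^{n_{\rm d}}$.
   Formalization: The coordinates η, the diffeomorphism Φ, the input transformation Γ_i and f_e, g_e, φ_l are asserted only on a neighbourhood of each point of U, since they need not exist on all of U (e.g. U an annulus, h=|x-c|²-4); ξ, a, b, δ, h_e, Γ_o remain global on U. *)

theory Defs
  imports "HOL-Analysis.Analysis" "Jordan_Normal_Form.DL_Rank"
begin

text \<open>
  The dimensions of the vectors and matrices produced by the algorithm depend on the computed
  ranks, so all values are vectors and matrices of Jordan_Normal_Form. Only the state space is a
  Euclidean type, \<^typ>\<open>real^'n\<close>, whose coordinate number \<open>j\<close> (\<open>j < CARD('n)\<close>) is the component
  \<^term>\<open>from_nat_into UNIV j\<close>. Below, \<open>$\<close> is the (0-based) vector access of Jordan_Normal_Form.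
\<close>

unbundle no vec_syntax

definition vec_to_state :: "real Matrix.vec \<Rightarrow> real^'n" where
  "vec_to_state v = vec_lambda (\<lambda>i. v $ to_nat_on (UNIV :: 'n set) i)"

text \<open>On open subsets of a finite-dimensional space this is the usual notion of class \<open>C^k\<close>.\<close>

primrec Ck_on :: "nat \<Rightarrow> 'a::real_normed_vector set \<Rightarrow> ('a \<Rightarrow> 'b::real_normed_vector) \<Rightarrow> bool" where
  "Ck_on 0 U F \<longleftrightarrow> continuous_on U F"
| "Ck_on (Suc k) U F \<longleftrightarrow>
     (\<forall>x\<in>U. F differentiable (at x)) \<and> (\<forall>w. Ck_on k U (\<lambda>x. frechet_derivative F (at x) w))"

definition smooth_on :: "'a::real_normed_vector set \<Rightarrow> ('a \<Rightarrow> 'b::real_normed_vector) \<Rightarrow> bool" where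
  "smooth_on U F \<longleftrightarrow> (\<forall>k. Ck_on k U F)"

definition smooth_vec_on ::
  "'a::real_normed_vector set \<Rightarrow> nat \<Rightarrow> ('a \<Rightarrow> real Matrix.vec) \<Rightarrow> bool" where
  "smooth_vec_on U r F \<longleftrightarrow>
     (\<forall>x\<in>U. F x \<in> carrier_vec r) \<and> (\<forall>i<r. smooth_on U (\<lambda>x. F x $ i))"

definition smooth_mat_on ::
  "'a::real_normed_vector set \<Rightarrow> nat \<Rightarrow> nat \<Rightarrow> ('a \<Rightarrow> real mat) \<Rightarrow> bool" where
  "smooth_mat_on U r c F \<longleftrightarrow>
     (\<forall>x\<in>U. F x \<in> carrier_mat r c) \<and> (\<forall>i<r. \<forall>j<c. smooth_on U (\<lambda>x. F x $$ (i, j)))"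

definition diffeomorphism_on ::
  "'a::real_normed_vector set \<Rightarrow> ('a \<Rightarrow> 'b::real_normed_vector) \<Rightarrow> bool" where
  "diffeomorphism_on V F \<longleftrightarrow> open V \<and> open (F ` V) \<and> inj_on F V \<and>
     smooth_on V F \<and> smooth_on (F ` V) (the_inv_into V F)"

definition mat_rank :: "real mat \<Rightarrow> nat" where
  "mat_rank A = vec_space.rank (dim_row A) A"

definition full_row_rank :: "real mat \<Rightarrow> bool" where
  "full_row_rank A \<longleftrightarrow> mat_rank A = dim_row A"

definition col_vec :: "real Matrix.vec list \<Rightarrow> real Matrix.vec" where
  "col_vec vs = foldr (@\<^sub>v) vs (0\<^sub>v 0)"

definition jac :: "(real^'n \<Rightarrow> real Matrix.vec) \<Rightarrow> real^'n \<Rightarrow> real mat" where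
  "jac F x = Matrix.mat (dim_vec (F x)) CARD('n)
     (\<lambda>(i, j). frechet_derivative (\<lambda>z. F z $ i) (at x) (axis (from_nat_into UNIV j) 1))"

definition Lie_f ::
  "(real^'n \<Rightarrow> real Matrix.vec) \<Rightarrow> (real^'n \<Rightarrow> real Matrix.vec) \<Rightarrow> real^'n \<Rightarrow> real Matrix.vec" where
  "Lie_f f F x = jac F x *\<^sub>v f x"

definition Lie_g ::
  "(real^'n \<Rightarrow> real mat) \<Rightarrow> (real^'n \<Rightarrow> real Matrix.vec) \<Rightarrow> real^'n \<Rightarrow> real mat" where
  "Lie_g g F x = jac F x * g x"

text \<open>
  A run of the algorithm is given by the ranks \<open>\<rho>\<close>, the constant matrices \<open>R\<close> and \<open>S\<close>, the matrix
  functions \<open>P\<close>, the outputs \<open>\<Theta>\<close> of the steps and the number \<open>kstar\<close> of the last step.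
\<close>

definition Omega ::
  "(nat \<Rightarrow> real mat) \<Rightarrow> (nat \<Rightarrow> real^'n \<Rightarrow> real Matrix.vec) \<Rightarrow> nat \<Rightarrow> real^'n \<Rightarrow> real Matrix.vec" where
  "Omega R \<Theta> k x = col_vec (map (\<lambda>l. R l *\<^sub>v \<Theta> (l - 1) x) [1..<Suc k])"

definition assumption_A ::
  "nat \<Rightarrow> (real^'n) set \<Rightarrow> (real^'n \<Rightarrow> real mat) \<Rightarrow> (nat \<Rightarrow> nat) \<Rightarrow> (nat \<Rightarrow> real mat) \<Rightarrow>
   (nat \<Rightarrow> real^'n \<Rightarrow> real Matrix.vec) \<Rightarrow> nat \<Rightarrow> bool" where
  "assumption_A p U g \<rho> R \<Theta> k \<longleftrightarrow>
     (\<forall>x\<in>U. mat_rank (Lie_g g (Omega R \<Theta> (k - 1)) x @\<^sub>r Lie_g g (\<Theta> (k - 1)) x) = \<rho> k) \<and>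
     R k \<in> carrier_mat (\<rho> k - \<rho> (k - 1)) (p - \<rho> (k - 1)) \<and>
     (\<forall>x\<in>U. let M = Lie_g g (Omega R \<Theta> (k - 1)) x @\<^sub>r Lie_g g (\<lambda>z. R k *\<^sub>v \<Theta> (k - 1) z) x
             in full_row_rank M \<and> mat_rank M = \<rho> k)"

definition n_upto :: "(nat \<Rightarrow> nat) \<Rightarrow> nat \<Rightarrow> nat" where
  "n_upto \<rho> k = (\<Sum>j=1..k. j * (\<rho> j - \<rho> (j - 1)))"

definition zero_structure_step ::
  "nat \<Rightarrow> (real^'n) set \<Rightarrow> (real^'n \<Rightarrow> real Matrix.vec) \<Rightarrow> (real^'n \<Rightarrow> real mat) \<Rightarrow>
   (nat \<Rightarrow> nat) \<Rightarrow> (nat \<Rightarrow> real mat) \<Rightarrow> (nat \<Rightarrow> real mat) \<Rightarrow> (nat \<Rightarrow> nat \<Rightarrow> real^'n \<Rightarrow> real mat) \<Rightarrow>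
   (nat \<Rightarrow> real^'n \<Rightarrow> real Matrix.vec) \<Rightarrow> nat \<Rightarrow> bool" where
  "zero_structure_step p U f g \<rho> R S P \<Theta> k \<longleftrightarrow>
     S k \<in> carrier_mat (p - \<rho> k) (p - \<rho> (k - 1)) \<and> invertible_mat (R k @\<^sub>r S k) \<and>
     (\<forall>l\<in>{1..k}. smooth_mat_on U (p - \<rho> k) (\<rho> l - \<rho> (l - 1)) (P k l)) \<and>
     (\<forall>x\<in>U. Lie_g g (\<lambda>z. S k *\<^sub>v \<Theta> (k - 1) z) x =
        Matrix.mat (p - \<rho> k) (dim_col (g x))
          (\<lambda>ij. \<Sum>l=1..k. (P k l x * Lie_g g (\<lambda>z. R l *\<^sub>v \<Theta> (l - 1) z) x) $$ ij)) \<and>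
     (\<forall>x\<in>U. \<Theta> k x = Lie_f f (\<lambda>z. S k *\<^sub>v \<Theta> (k - 1) z) x -
        Matrix.vec (p - \<rho> k)
          (\<lambda>i. \<Sum>l=1..k. (P k l x *\<^sub>v Lie_f f (\<lambda>z. R l *\<^sub>v \<Theta> (l - 1) z) x) $ i))"

text \<open>\<open>kstar\<close> is the first step (at least 1) at which the condition for continuing fails.\<close>

definition zero_structure_run ::
  "nat \<Rightarrow> nat \<Rightarrow> (real^'n) set \<Rightarrow> (real^'n \<Rightarrow> real Matrix.vec) \<Rightarrow> (real^'n \<Rightarrow> real mat) \<Rightarrow>
   (real^'n \<Rightarrow> real Matrix.vec) \<Rightarrow>
   (nat \<Rightarrow> nat) \<Rightarrow> (nat \<Rightarrow> real mat) \<Rightarrow> (nat \<Rightarrow> real mat) \<Rightarrow> (nat \<Rightarrow> nat \<Rightarrow> real^'n \<Rightarrow> real mat) \<Rightarrow>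
   (nat \<Rightarrow> real^'n \<Rightarrow> real Matrix.vec) \<Rightarrow> nat \<Rightarrow> bool" where
  "zero_structure_run m p U f g h \<rho> R S P \<Theta> kstar \<longleftrightarrow>
     \<rho> 0 = 0 \<and> \<Theta> 0 = h \<and> 1 \<le> kstar \<and>
     (\<forall>k\<in>{1..kstar}. zero_structure_step p U f g \<rho> R S P \<Theta> k) \<and>
     (\<forall>k\<in>{1..<kstar}. k + n_upto \<rho> k < CARD('n) \<and> \<rho> k < min p m) \<and>
     \<not> (kstar + n_upto \<rho> kstar < CARD('n) \<and> \<rho> kstar < min p m)"

definition regular ::
  "nat \<Rightarrow> (real^'n) set \<Rightarrow> (real^'n \<Rightarrow> real mat) \<Rightarrow> (nat \<Rightarrow> nat) \<Rightarrow> (nat \<Rightarrow> real mat) \<Rightarrow>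
   (nat \<Rightarrow> real^'n \<Rightarrow> real Matrix.vec) \<Rightarrow> nat \<Rightarrow> bool" where
  "regular p U g \<rho> R \<Theta> kstar \<longleftrightarrow> (\<forall>k\<in>{1..kstar}. assumption_A p U g \<rho> R \<Theta> k)"

definition q_list :: "(nat \<Rightarrow> nat) \<Rightarrow> nat \<Rightarrow> nat list" where
  "q_list \<rho> kstar = concat (map (\<lambda>j. replicate (\<rho> j - \<rho> (j - 1)) j) [1..<Suc kstar])"

text \<open>\<open>S_chain p \<rho> S i j\<close> is \<open>S i * S (i - 1) * \<dots> * S j\<close>, the identity if \<open>j > i\<close> (for \<open>j \<ge> 1\<close>).\<close>

primrec S_chain :: "nat \<Rightarrow> (nat \<Rightarrow> nat) \<Rightarrow> (nat \<Rightarrow> real mat) \<Rightarrow> nat \<Rightarrow> nat \<Rightarrow> real mat" where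
  "S_chain p \<rho> S 0 j = 1\<^sub>m (p - \<rho> 0)"
| "S_chain p \<rho> S (Suc i) j =
     (if Suc i < j then 1\<^sub>m (p - \<rho> (Suc i)) else S (Suc i) * S_chain p \<rho> S i j)"

definition zeta ::
  "nat \<Rightarrow> (nat \<Rightarrow> nat) \<Rightarrow> (nat \<Rightarrow> real mat) \<Rightarrow> (nat \<Rightarrow> real mat) \<Rightarrow>
   (nat \<Rightarrow> real^'n \<Rightarrow> real Matrix.vec) \<Rightarrow> nat \<Rightarrow> nat \<Rightarrow> real^'n \<Rightarrow> real Matrix.vec" where
  "zeta p \<rho> R S \<Theta> i j x = (R i * S_chain p \<rho> S (i - 1) j) *\<^sub>v \<Theta> (j - 1) x"

definition Phi_d ::
  "nat \<Rightarrow> (nat \<Rightarrow> nat) \<Rightarrow> (nat \<Rightarrow> real mat) \<Rightarrow> (nat \<Rightarrow> real mat) \<Rightarrow>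
   (nat \<Rightarrow> real^'n \<Rightarrow> real Matrix.vec) \<Rightarrow> nat \<Rightarrow> real^'n \<Rightarrow> real Matrix.vec" where
  "Phi_d p \<rho> R S \<Theta> kstar x =
     col_vec (map (\<lambda>i. col_vec (map (\<lambda>j. zeta p \<rho> R S \<Theta> i j x) [1..<Suc i])) [1..<Suc kstar])"

end

theory Submission
  imports Defs
begin

text \<open>
  Put \<open>v = L\<^sub>f \<Omega>\<^sub>K + L\<^sub>g \<Omega>\<^sub>K u\<close>, the derivative of \<open>\<Omega>\<^sub>K\<close> along the system, with blocks \<open>v\<^sub>(\<^sub>l\<^sub>)\<close>. The
  definition of \<open>\<Theta>\<^sub>k\<close> says that \<open>S\<^sub>k \<Theta>\<^sub>k\<^sub>-\<^sub>1\<close> has derivative \<open>\<Theta>\<^sub>k + \<Sum>\<^sub>l\<^sub>\<le>\<^sub>k P\<^sub>k\<^sub>,\<^sub>l v\<^sub>(\<^sub>l\<^sub>)\<close>. Multiplying by the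
  constant matrix \<open>R\<^sub>c S\<^sub>c\<^sub>-\<^sub>1 \<cdots> S\<^sub>j\<^sub>+\<^sub>1\<close> gives the derivative of \<open>\<zeta>\<^sub>c\<^sub>,\<^sub>j\<close> for \<open>j < c\<close>: it is \<open>\<zeta>\<^sub>c\<^sub>,\<^sub>j\<^sub>+\<^sub>1\<close> plus terms
  in the blocks \<open>v\<^sub>(\<^sub>l\<^sub>)\<close> with \<open>l \<le> j\<close> only, while \<open>\<zeta>\<^sub>c\<^sub>,\<^sub>c = R\<^sub>c \<Theta>\<^sub>c\<^sub>-\<^sub>1\<close> has derivative \<open>v\<^sub>(\<^sub>c\<^sub>)\<close>. So the rows of the
  \<open>\<zeta>\<^sub>c\<^sub>,\<^sub>j\<close>, grouped into chains, are the coordinates \<open>\<xi>\<close>. Near a given point, linear functions \<open>\<eta>\<close> complete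
  them to a diffeomorphism by the inverse function theorem, and a constant matrix completes \<open>L\<^sub>g \<Omega>\<^sub>K\<close> to
  a nonsingular \<open>\<Gamma>\<^sub>i\<close>; solving for \<open>u\<close> in terms of \<open>u\<^sub>e\<close> and \<open>v\<close> gives the equation for \<open>\<eta>\<close>.
\<close>

section \<open>Calculus of class \<open>C\<^sup>k\<close>\<close>

lemma has_derivative_cong_open:
  assumes "open U" "x \<in> U" "\<And>z. z \<in> U \<Longrightarrow> F z = G z"
  shows "(F has_derivative D) (at x) \<longleftrightarrow> (G has_derivative D) (at x)"
  using has_derivative_transform_within_open[OF _ assms(1,2), of F D UNIV G]
    has_derivative_transform_within_open[OF _ assms(1,2), of G D UNIV F] assms(3) by auto

lemma frechet_derivative_cong_open:
  assumes "open U" "x \<in> U" "\<And>z. z \<in> U \<Longrightarrow> F z = G z"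
  shows "frechet_derivative F (at x) = frechet_derivative G (at x)"
  using has_derivative_cong_open[OF assms] by (simp add: frechet_derivative_def)

text \<open>Openness of \<open>U\<close> makes derivatives at points of \<open>U\<close> depend on
  values in \<open>U\<close> only. The induction is over all \<open>F\<close> and \<open>G\<close>,
  so that it applies to their directional derivatives.\<close>

lemma Ck_on_cong:
  assumes "open U" "\<And>x. x \<in> U \<Longrightarrow> F x = G x"
  shows "Ck_on k U F \<longleftrightarrow> Ck_on k U G"
  using assms(2)
proof (induction k arbitrary: F G)
  case 0
  then show ?case by (auto cong: continuous_on_cong)
next
  case (Suc k)
  have 1: "F differentiable (at x) \<longleftrightarrow> G differentiable (at x)" if "x \<in> U" for x
    using has_derivative_cong_open[OF assms(1) that, of F G] Suc.prems by (simp add: differentiable_def)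
  have 2: "frechet_derivative F (at x) = frechet_derivative G (at x)" if "x \<in> U" for x
    using frechet_derivative_cong_open[OF assms(1) that] Suc.prems by blast
  have "Ck_on k U (\<lambda>x. frechet_derivative F (at x) w)
      \<longleftrightarrow> Ck_on k U (\<lambda>x. frechet_derivative G (at x) w)" for w
    using 2 by (intro Suc.IH) simp
  with 1 show ?case by simp
qed

text \<open>Derivatives are unique, so an explicit family \<open>F'\<close> may replace the chosen
  \<open>frechet_derivative\<close> in the definition of \<open>Ck_on\<close>. The closure
  properties below compute such a family and apply induction to it.\<close>

lemma Ck_on_SucI:
  assumes "open U" "\<And>x. x \<in> U \<Longrightarrow> (F has_derivative F' x) (at x)"
    and "\<And>w. Ck_on k U (\<lambda>x. F' x w)"
  shows "Ck_on (Suc k) U F"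
proof -
  have "frechet_derivative F (at x) = F' x" if "x \<in> U" for x
    using frechet_derivative_at assms(2)[OF that] by metis
  then have "Ck_on k U (\<lambda>x. frechet_derivative F (at x) w)" for w
    using Ck_on_cong[OF assms(1), of "\<lambda>x. frechet_derivative F (at x) w" "\<lambda>x. F' x w" k] assms(3)
    by simp
  then show ?thesis
    using assms(2) by (auto simp: differentiable_def)
qed

lemma Ck_on_SucD:
  assumes "Ck_on (Suc k) U F"
  shows "x \<in> U \<Longrightarrow> (F has_derivative frechet_derivative F (at x)) (at x)"
    and "Ck_on k U (\<lambda>x. frechet_derivative F (at x) w)"
  using assms frechet_derivative_works by auto

lemma Ck_on_mono_Suc: "Ck_on (Suc k) U F \<Longrightarrow> Ck_on k U F"
proof (induction k arbitrary: F)
  case 0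
  then have "F differentiable (at x)" if "x \<in> U" for x using that by simp
  then show ?case
    by (simp add: continuous_at_imp_continuous_on differentiable_imp_continuous_within)
next
  case (Suc k)
  then have "Ck_on k U (\<lambda>x. frechet_derivative F (at x) w)" for w
    using Ck_on_SucD(2)[OF Suc.prems] by simp
  with Suc.prems show ?case by simp
qed

lemma Ck_on_subset: "Ck_on k U F \<Longrightarrow> V \<subseteq> U \<Longrightarrow> Ck_on k V F"
  by (induction k arbitrary: F) (auto intro: continuous_on_subset)

lemma Ck_on_const: "Ck_on k U (\<lambda>x. c)"
  by (induction k arbitrary: c) auto

lemma Ck_on_bounded_linear:
  assumes "open U" "bounded_linear L"
  shows "Ck_on k U L"
proof (cases k)
  case 0
  then show ?thesis using assms(2) by (simp add: linear_continuous_on)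
next
  case (Suc j)
  then show ?thesis
    using Ck_on_SucI[OF assms(1), of L "\<lambda>x. L" j] assms(2)
    by (auto intro: Ck_on_const bounded_linear_imp_has_derivative)
qed

lemma Ck_on_add:
  assumes "open U" "Ck_on k U F" "Ck_on k U G"
  shows "Ck_on k U (\<lambda>x. F x + G x)"
  using assms(2,3)
proof (induction k arbitrary: F G)
  case (Suc k)
  show ?case
    by (rule Ck_on_SucI[OF assms(1) has_derivative_add[OF
          Ck_on_SucD(1)[OF Suc.prems(1)] Ck_on_SucD(1)[OF Suc.prems(2)]]])
      (assumption | rule Suc.IH Ck_on_SucD(2)[OF Suc.prems(1)] Ck_on_SucD(2)[OF Suc.prems(2)])+
qed (auto intro: continuous_on_add)

lemma Ck_on_scaleR:
  fixes F :: "'a::real_normed_vector \<Rightarrow> real"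
  assumes "open U" "Ck_on k U F" "Ck_on k U G"
  shows "Ck_on k U (\<lambda>x. F x *\<^sub>R G x)"
  using assms(2,3)
proof (induction k arbitrary: F G)
  case (Suc k)
  show ?case
  proof (rule Ck_on_SucI[OF assms(1)])
    show "((\<lambda>x. F x *\<^sub>R G x) has_derivative (\<lambda>w. F x *\<^sub>R frechet_derivative G (at x) w
        + frechet_derivative F (at x) w *\<^sub>R G x)) (at x)" if "x \<in> U" for x
      by (intro has_derivative_scaleR Ck_on_SucD[OF Suc.prems(1)] Ck_on_SucD[OF Suc.prems(2)] that)
    show "Ck_on k U (\<lambda>x. F x *\<^sub>R frechet_derivative G (at x) w
        + frechet_derivative F (at x) w *\<^sub>R G x)" for w
      by (intro Ck_on_add assms(1) Suc.IH Ck_on_mono_Suc[OF Suc.prems(1)]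
          Ck_on_mono_Suc[OF Suc.prems(2)] Ck_on_SucD(2)[OF Suc.prems(1)] Ck_on_SucD(2)[OF Suc.prems(2)])
  qed
qed (auto intro: continuous_on_scaleR)

lemma Ck_on_mult:
  fixes F G :: "'a::real_normed_vector \<Rightarrow> real"
  assumes "open U" "Ck_on k U F" "Ck_on k U G"
  shows "Ck_on k U (\<lambda>x. F x * G x)"
  using Ck_on_scaleR[OF assms] by simp

lemma Ck_on_sum:
  assumes "open U" "\<And>i. i \<in> I \<Longrightarrow> Ck_on k U (F i)"
  shows "Ck_on k U (\<lambda>x. \<Sum>i\<in>I. F i x)"
  using assms(2)
proof (induction I rule: infinite_finite_induct)
  case (insert i I)
  then show ?case using Ck_on_add[OF assms(1), of k "F i"] by simp
qed (auto intro: Ck_on_const)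

text \<open>The derivative of the reciprocal is a product of two copies of the reciprocal and a
  derivative of \<open>F\<close>, so induction on \<open>k\<close> with \<open>F\<close> fixed is
  enough.\<close>

lemma Ck_on_inverse:
  fixes F :: "'a::real_normed_vector \<Rightarrow> real"
  assumes "open U" "Ck_on k U F" "\<And>x. x \<in> U \<Longrightarrow> F x \<noteq> 0"
  shows "Ck_on k U (\<lambda>x. inverse (F x))"
  using assms(2)
proof (induction k)
  case 0
  then show ?case using assms(3) by (auto intro: continuous_on_inverse)
next
  case (Suc k)
  show ?case
  proof (rule Ck_on_SucI[OF assms(1)])
    show "((\<lambda>x. inverse (F x)) has_derivative
        (\<lambda>w. - (inverse (F x) * frechet_derivative F (at x) w * inverse (F x)))) (at x)"
      if "x \<in> U" for x
      by (rule Deriv.has_derivative_inverse[OF assms(3)[OF that] Ck_on_SucD(1)[OF Suc.prems that]])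
    have "Ck_on k U (\<lambda>x. (- 1) * (inverse (F x) * frechet_derivative F (at x) w * inverse (F x)))" for w
      by (intro Ck_on_mult assms(1) Suc.IH Ck_on_const Ck_on_mono_Suc[OF Suc.prems]
          Ck_on_SucD(2)[OF Suc.prems])
    then show "Ck_on k U (\<lambda>x. - (inverse (F x) * frechet_derivative F (at x) w * inverse (F x)))" for w
      by simp
  qed
qed

text \<open>The chain rule applies the derivative of \<open>F\<close> to a direction that varies
  with \<open>x\<close>, whereas \<open>Ck_on\<close> speaks of fixed directions. Expanding that
  direction in the finite basis leaves sums of products, and induction over all \<open>F\<close>
  covers the derivatives of \<open>F\<close> along basis vectors.\<close>

lemma Ck_on_compose:
  fixes G :: "'a::real_normed_vector \<Rightarrow> 'b::euclidean_space"
  assumes "open U" "open V" "G ` U \<subseteq> V" "Ck_on k V F" "Ck_on k U G"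
  shows "Ck_on k U (\<lambda>x. F (G x))"
  using assms(4,5)
proof (induction k arbitrary: F)
  case 0
  then show ?case using continuous_on_compose2[OF _ _ assms(3)] by auto
next
  case (Suc k)
  let ?DF = "\<lambda>x. frechet_derivative F (at x)" and ?DG = "\<lambda>x. frechet_derivative G (at x)"
  show ?case
  proof (rule Ck_on_SucI[OF assms(1)])
    fix x assume x: "x \<in> U"
    have dF: "(F has_derivative ?DF (G x)) (at (G x))"
      using Ck_on_SucD(1)[OF Suc.prems(1)] x assms(3) by blast
    have rep: "?DF (G x) v = (\<Sum>b\<in>Basis. (v \<bullet> b) *\<^sub>R ?DF (G x) b)" for v
    proof -
      have lin: "linear (?DF (G x))" using dF has_derivative_linear by blast
      have "?DF (G x) v = ?DF (G x) (\<Sum>b\<in>Basis. (v \<bullet> b) *\<^sub>R b)"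
        by (simp only: euclidean_representation)
      also have "\<dots> = (\<Sum>b\<in>Basis. (v \<bullet> b) *\<^sub>R ?DF (G x) b)"
        by (simp only: linear_sum[OF lin] linear_cmul[OF lin])
      finally show ?thesis .
    qed
    show "((\<lambda>x. F (G x)) has_derivative
        (\<lambda>w. \<Sum>b\<in>Basis. (?DG x w \<bullet> b) *\<^sub>R ?DF (G x) b)) (at x)"
      by (rule has_derivative_eq_rhs[OF has_derivative_compose[OF Ck_on_SucD(1)[OF Suc.prems(2) x] dF]])
        (rule ext, rule rep)
  next
    fix w
    have "Ck_on k U (\<lambda>x. ?DG x w \<bullet> b)" for b
    proof -
      have lin: "bounded_linear (\<lambda>v. v \<bullet> b)" by (rule bounded_linear_inner_left)
      \<comment> \<open>This needs its own induction: the outer hypothesis only concerns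
        compositions with \<open>G\<close>, not with the derivatives of \<open>G\<close>.\<close>
      have "Ck_on j U H \<Longrightarrow> Ck_on j U (\<lambda>x. H x \<bullet> b)" for j and H :: "'a \<Rightarrow> 'b"
      proof (induction j arbitrary: H)
        case 0
        then show ?case by (auto intro: continuous_on_inner continuous_on_const)
      next
        case (Suc j)
        show ?case
          by (rule Ck_on_SucI[OF assms(1) bounded_linear.has_derivative[OF lin
                  Ck_on_SucD(1)[OF Suc.prems]]])
            (assumption | rule Suc.IH Ck_on_SucD(2)[OF Suc.prems])+
      qed
      then show ?thesis using Ck_on_SucD(2)[OF Suc.prems(2)] by blast
    qed
    moreover have "Ck_on k U (\<lambda>x. ?DF (G x) b)" for b
      by (intro Suc.IH Ck_on_SucD(2)[OF Suc.prems(1)] Ck_on_mono_Suc[OF Suc.prems(2)])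
    ultimately show "Ck_on k U (\<lambda>x. \<Sum>b\<in>Basis. (?DG x w \<bullet> b) *\<^sub>R ?DF (G x) b)"
      by (intro Ck_on_sum Ck_on_scaleR assms(1)) auto
  qed
qed

lemma Ck_on_vec_lambda:
  fixes F :: "'a::real_normed_vector \<Rightarrow> real^'n"
  assumes "open U" "\<And>i. Ck_on k U (\<lambda>x. vec_nth (F x) i)"
  shows "Ck_on k U F"
proof -
  have "F = (\<lambda>x. \<Sum>i\<in>UNIV. vec_nth (F x) i *\<^sub>R axis i 1)"
    using basis_expansion[of "F _"] by (simp add: scalar_mult_eq_scaleR)
  moreover have "Ck_on k U (\<lambda>x. \<Sum>i\<in>UNIV. vec_nth (F x) i *\<^sub>R axis i (1::real))"
    by (intro Ck_on_sum Ck_on_scaleR Ck_on_const assms)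
  ultimately show ?thesis by simp
qed

section \<open>Closure properties of smooth functions\<close>

lemma smooth_on_cong:
  "open U \<Longrightarrow> (\<And>x. x \<in> U \<Longrightarrow> F x = G x) \<Longrightarrow> smooth_on U F \<longleftrightarrow> smooth_on U G"
  unfolding smooth_on_def using Ck_on_cong[of U F G] by simp

lemma smooth_on_subset: "smooth_on U F \<Longrightarrow> V \<subseteq> U \<Longrightarrow> smooth_on V F"
  unfolding smooth_on_def using Ck_on_subset by blast

lemma smooth_on_const: "smooth_on U (\<lambda>x. c)"
  by (simp add: smooth_on_def Ck_on_const)

lemma smooth_on_bounded_linear: "open U \<Longrightarrow> bounded_linear L \<Longrightarrow> smooth_on U L"
  by (simp add: smooth_on_def Ck_on_bounded_linear)

lemma smooth_on_add: "open U \<Longrightarrow> smooth_on U F \<Longrightarrow> smooth_on U G \<Longrightarrow> smooth_on U (\<lambda>x. F x + G x)"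
  by (simp add: smooth_on_def Ck_on_add)

lemma smooth_on_mult:
  fixes F G :: "'a::real_normed_vector \<Rightarrow> real"
  shows "open U \<Longrightarrow> smooth_on U F \<Longrightarrow> smooth_on U G \<Longrightarrow> smooth_on U (\<lambda>x. F x * G x)"
  by (simp add: smooth_on_def Ck_on_mult)

lemma smooth_on_diff:
  fixes F G :: "'a::real_normed_vector \<Rightarrow> real"
  assumes "open U" "smooth_on U F" "smooth_on U G"
  shows "smooth_on U (\<lambda>x. F x - G x)"
  using smooth_on_add[OF assms(1,2) smooth_on_mult[OF assms(1) smooth_on_const[of U "-1"] assms(3)]]
  by simp

lemma smooth_on_sum:
  "open U \<Longrightarrow> (\<And>i. i \<in> I \<Longrightarrow> smooth_on U (F i)) \<Longrightarrow> smooth_on U (\<lambda>x. \<Sum>i\<in>I. F i x)"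
  by (simp add: smooth_on_def Ck_on_sum)

lemma smooth_on_prod:
  fixes F :: "'i \<Rightarrow> 'a::real_normed_vector \<Rightarrow> real"
  assumes "open U" "\<And>i. i \<in> I \<Longrightarrow> smooth_on U (F i)"
  shows "smooth_on U (\<lambda>x. \<Prod>i\<in>I. F i x)"
  using assms(2)
proof (induction I rule: infinite_finite_induct)
  case (insert i I)
  then show ?case using smooth_on_mult[OF assms(1), of "F i"] by simp
qed (auto intro: smooth_on_const)

lemma smooth_on_inverse:
  fixes F :: "'a::real_normed_vector \<Rightarrow> real"
  shows "open U \<Longrightarrow> smooth_on U F \<Longrightarrow> (\<And>x. x \<in> U \<Longrightarrow> F x \<noteq> 0) \<Longrightarrow> smooth_on U (\<lambda>x. inverse (F x))"
  by (simp add: smooth_on_def Ck_on_inverse)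

lemma smooth_on_has_derivative:
  "smooth_on U F \<Longrightarrow> x \<in> U \<Longrightarrow> (F has_derivative frechet_derivative F (at x)) (at x)"
  unfolding smooth_on_def by (rule Ck_on_SucD(1)) (erule spec)

lemma smooth_on_derivative: "smooth_on U F \<Longrightarrow> smooth_on U (\<lambda>x. frechet_derivative F (at x) w)"
  unfolding smooth_on_def by (rule allI, rule Ck_on_SucD(2)) (erule spec)

lemma smooth_on_continuous_on: "smooth_on U F \<Longrightarrow> continuous_on U F"
  unfolding smooth_on_def Ck_on.simps(1)[symmetric] by (erule spec)

section \<open>The smooth inverse function theorem\<close>

lemma Ck_on_det:
  fixes A :: "'a::real_normed_vector \<Rightarrow> real^'n^'n"
  assumes "open U" "\<And>i j. Ck_on k U (\<lambda>x. vec_nth (vec_nth (A x) i) j)"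
  shows "Ck_on k U (\<lambda>x. Determinants.det (A x))"
proof -
  have "Ck_on k U (\<lambda>x. \<Prod>i\<in>I. vec_nth (vec_nth (A x) i) (s i))" if "finite I" for I and s :: "'n \<Rightarrow> 'n"
    using that by (induction I) (auto intro: Ck_on_const Ck_on_mult assms)
  then show ?thesis
    unfolding Determinants.det_def by (intro Ck_on_sum Ck_on_mult Ck_on_const assms(1)) auto
qed

text \<open>By Cramer's rule the derivative \<open>(F'(G y))\<^sup>-\<^sup>1\<close> of the local inverse \<open>G\<close> is as often
  differentiable as \<open>G\<close>, hence \<open>G\<close> is once more differentiable.\<close>

lemma Ck_on_inverse_function:
  fixes F G :: "real^'n \<Rightarrow> real^'n"
  assumes "open U" "open V" "smooth_on U F" "G ` V \<subseteq> U"
    and G: "\<And>y. y \<in> V \<Longrightarrow> (G has_derivative G' y) (at y)"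
    and inv: "\<And>y w. y \<in> V \<Longrightarrow> frechet_derivative F (at (G y)) (G' y w) = w"
    and inj: "\<And>y. y \<in> V \<Longrightarrow> inj (frechet_derivative F (at (G y)))"
  shows "Ck_on k V G"
proof (induction k)
  case 0
  then show ?case
    using has_derivative_continuous[OF G] by (simp add: continuous_at_imp_continuous_on)
next
  case (Suc k)
  let ?D = "\<lambda>x. matrix (frechet_derivative F (at x))"
  show ?case
  proof (rule Ck_on_SucI[OF assms(2) G])
    fix w
    \<comment> \<open>The numerator of Cramer's rule: the Jacobian at \<open>G y\<close> with column
      \<open>i\<close> replaced by \<open>w\<close>.\<close>
    define M where "M y i = vec_lambda (\<lambda>r. vec_lambda (\<lambda>c.
        if c = i then vec_nth w r else vec_nth (vec_nth (?D (G y)) r) c))" for y i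
    have ent: "Ck_on k V (\<lambda>y. vec_nth (vec_nth (?D (G y)) r) c)" for r c
    proof -
      have "smooth_on U (\<lambda>x. frechet_derivative F (at x) (axis c 1))"
        by (rule smooth_on_derivative[OF assms(3)])
      then have "Ck_on k V (\<lambda>y. frechet_derivative F (at (G y)) (axis c 1))"
        unfolding smooth_on_def by (intro Ck_on_compose[OF assms(2,1,4) _ Suc.IH]) (rule spec)
      moreover have "Ck_on k UNIV (\<lambda>v::real^'n. vec_nth v r)"
        by (intro Ck_on_bounded_linear bounded_linear_vec_nth) simp
      ultimately have "Ck_on k V (\<lambda>y. vec_nth (frechet_derivative F (at (G y)) (axis c 1)) r)"
        by (rule Ck_on_compose[OF assms(2) open_UNIV subset_UNIV, rotated])
      then show ?thesis by (simp add: matrix_def)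
    qed
    have eq: "vec_nth (G' y w) i = Determinants.det (M y i) * inverse (Determinants.det (?D (G y)))"
      and det: "Determinants.det (?D (G y)) \<noteq> 0" if "y \<in> V" for y i
    proof -
      have lin: "linear (frechet_derivative F (at (G y)))"
        using smooth_on_has_derivative[OF assms(3)] assms(4) that has_derivative_linear by blast
      show det: "Determinants.det (?D (G y)) \<noteq> 0"
        using inj[OF that] lin det_nz_iff_inj by blast
      have "?D (G y) *v G' y w = w"
        using inv[OF that] lin by (simp add: matrix_works)
      then have "G' y w = vec_lambda (\<lambda>k. Determinants.det (vec_lambda (\<lambda>i. vec_lambda (\<lambda>j.
          if j = k then vec_nth w i else vec_nth (vec_nth (?D (G y)) i) j))) / Determinants.det (?D (G y)))"
        using cramer[OF det] by blast
      then show "vec_nth (G' y w) i = Determinants.det (M y i) * inverse (Determinants.det (?D (G y)))"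
        by (simp add: M_def divide_inverse)
    qed
    have "Ck_on k V (\<lambda>y. Determinants.det (M y i) * inverse (Determinants.det (?D (G y))))" for i
    proof (intro Ck_on_mult Ck_on_inverse Ck_on_det assms(2) ent det)
      show "Ck_on k V (\<lambda>x. vec_nth (vec_nth (M x i) r) c)" for r c
        by (cases "c = i") (auto simp: M_def intro: Ck_on_const ent)
    qed
    then have "Ck_on k V (\<lambda>y. vec_nth (G' y w) i)" for i
      by (subst Ck_on_cong[OF assms(2) eq])
    then show "Ck_on k V (\<lambda>y. G' y w)"
      by (rule Ck_on_vec_lambda[OF assms(2)])
  qed
qed

text \<open>The classical theorem yields a differentiable local inverse, once the derivative is
  continuous in operator norm and has a left inverse at \<open>x0\<close>.
  \<open>Ck_on_inverse_function\<close> then raises the inverse to every class.\<close>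

lemma smooth_inverse_function_theorem:
  fixes F :: "real^'n \<Rightarrow> real^'n"
  assumes "open U" "x0 \<in> U" "smooth_on U F" "inj (frechet_derivative F (at x0))"
  obtains V where "open V" "x0 \<in> V" "V \<subseteq> U" "diffeomorphism_on V F"
proof -
  let ?D = "\<lambda>x. frechet_derivative F (at x)"
  define F' where "F' x = Blinfun (?D x)" for x
  have bl: "bounded_linear (?D x)" if "x \<in> U" for x
    using smooth_on_has_derivative[OF assms(3) that] has_derivative_bounded_linear by blast
  have ap: "blinfun_apply (F' x) = ?D x" if "x \<in> U" for x
    using bl[OF that] by (simp add: F'_def bounded_linear_Blinfun_apply)
  have der: "(F has_derivative blinfun_apply (F' x)) (at x)" if "x \<in> U" for x
    using smooth_on_has_derivative[OF assms(3) that] ap[OF that] by simp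
  \<comment> \<open>In finite dimension, continuity of each directional derivative gives continuity
    in operator norm.\<close>
  have cont: "continuous_on U F'"
  proof (rule continuous_on_blinfun_componentwise)
    fix i :: "real^'n"
    have "continuous_on U (\<lambda>x. ?D x i)"
      by (intro smooth_on_continuous_on smooth_on_derivative assms(3))
    then show "continuous_on U (\<lambda>x. blinfun_apply (F' x) i)"
      using ap by (auto cong: continuous_on_cong)
  qed
  obtain L where L: "linear L" "L \<circ> ?D x0 = id"
    using linear_injective_left_inverse[OF bounded_linear.linear[OF bl[OF assms(2)]] assms(4)] by blast
  have "bounded_linear L" using L(1) linear_conv_bounded_linear by blast
  then have left_inv: "Blinfun L o\<^sub>L F' x0 = id_blinfun"
    using L(2) ap[OF assms(2)] by (intro blinfun_eqI)
      (simp add: bounded_linear_Blinfun_apply o_def fun_eq_iff)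
  obtain V W G G' where *: "open V" "V \<subseteq> U" "x0 \<in> V" "open W" "F x0 \<in> W"
    "homeomorphism V W F G" "\<And>y. y \<in> W \<Longrightarrow> (G has_derivative (G' y)) (at y)"
    "\<And>y. y \<in> W \<Longrightarrow> G' y = inv_into UNIV (blinfun_apply (F' (G y)))"
    "\<And>y. y \<in> W \<Longrightarrow> bij (blinfun_apply (F' (G y)))"
    by (rule inverse_function_theorem[OF assms(1) der cont assms(2) left_inv]) blast+
  have FV: "F ` V = W" and GW: "G ` W = V" and GF: "\<And>x. x \<in> V \<Longrightarrow> G (F x) = x"
    using *(6) by (auto simp: homeomorphism_def)
  have inj: "inj_on F V" using GF by (metis inj_onI)
  have "smooth_on W G"
    unfolding smooth_on_def
  proof
    fix k
    have in_U: "G y \<in> U" if "y \<in> W" for y using that GW *(2) by blast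
    show "Ck_on k W G"
    proof (rule Ck_on_inverse_function[OF assms(1) *(4) assms(3) _ *(7)])
      show "G ` W \<subseteq> U" using in_U by blast
      show "inj (?D (G y))" if "y \<in> W" for y
        using *(9)[OF that] ap[OF in_U[OF that]] by (simp add: bij_is_inj)
      show "?D (G y) (G' y w) = w" if "y \<in> W" for y w
        using *(8,9)[OF that] ap[OF in_U[OF that]] by (simp add: bij_is_surj surj_f_inv_f)
    qed auto
  qed
  moreover have "the_inv_into V F y = G y" if "y \<in> W" for y
    using that FV GF inj by (metis imageE the_inv_into_f_f)
  ultimately have "smooth_on (F ` V) (the_inv_into V F)"
    using smooth_on_cong[OF *(4), of "the_inv_into V F" G] FV by simp
  then have "diffeomorphism_on V F"
    using *(1,4) FV inj smooth_on_subset[OF assms(3) *(2)] by (simp add: diffeomorphism_on_def)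
  with that *(1,2,3) show thesis by blast
qed

section \<open>Real matrices and smooth matrix functions\<close>

lemma index_append_rows:
  assumes "A \<in> carrier_mat r1 c" "B \<in> carrier_mat r2 c" "i < r1 + r2" "j < c"
  shows "(A @\<^sub>r B) $$ (i, j) = (if i < r1 then A $$ (i, j) else B $$ (i - r1, j))"
  using assms by (auto simp: append_rows_def)

lemma zero_append_rows: "A \<in> carrier_mat r c \<Longrightarrow> 0\<^sub>m 0 c @\<^sub>r A = A"
  by (intro eq_matI) (auto simp: append_rows_def)

lemma append_rows_assoc:
  assumes "A \<in> carrier_mat r1 c" "B \<in> carrier_mat r2 c" "C \<in> carrier_mat r3 c"
  shows "(A @\<^sub>r B) @\<^sub>r C = A @\<^sub>r (B @\<^sub>r C)"
proof (rule eq_matI)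
  have d: "A @\<^sub>r B \<in> carrier_mat (r1 + r2) c" "B @\<^sub>r C \<in> carrier_mat (r2 + r3) c"
    "(A @\<^sub>r B) @\<^sub>r C \<in> carrier_mat (r1 + r2 + r3) c" "A @\<^sub>r (B @\<^sub>r C) \<in> carrier_mat (r1 + (r2 + r3)) c"
    using assms by (meson carrier_append_rows)+
  then show "dim_row ((A @\<^sub>r B) @\<^sub>r C) = dim_row (A @\<^sub>r (B @\<^sub>r C))"
    "dim_col ((A @\<^sub>r B) @\<^sub>r C) = dim_col (A @\<^sub>r (B @\<^sub>r C))" by auto
  fix i j assume "i < dim_row (A @\<^sub>r (B @\<^sub>r C))" "j < dim_col (A @\<^sub>r (B @\<^sub>r C))"
  then have "i < r1 + r2 + r3" "j < c" using d(4) by auto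
  then show "((A @\<^sub>r B) @\<^sub>r C) $$ (i, j) = (A @\<^sub>r (B @\<^sub>r C)) $$ (i, j)"
    using index_append_rows[OF d(1) assms(3), of i j] index_append_rows[OF assms(1) d(2), of i j]
      index_append_rows[OF assms(1,2), of i j] index_append_rows[OF assms(2,3), of "i - r1" j] by auto
qed

lemma scalar_prod_self_eq_0:
  fixes v :: "real Matrix.vec"
  assumes "v \<in> carrier_vec n" "v \<bullet> v = 0"
  shows "v = 0\<^sub>v n"
proof (rule eq_vecI)
  have "(\<Sum>i = 0..<n. v $ i * v $ i) = 0"
    using assms by (simp add: Matrix.scalar_prod_def)
  then have "\<forall>i\<in>{0..<n}. v $ i * v $ i = 0"
    by (subst (asm) sum_nonneg_eq_0_iff) auto
  then show "v $ i = 0\<^sub>v n $ i" if "i < dim_vec (0\<^sub>v n)" for i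
    using that by simp
qed (use assms in auto)

text \<open>The adjugate divided by the determinant is a two-sided inverse; conversely, determinants
  are multiplicative.\<close>

lemma invertible_mat_iff_det:
  fixes A :: "real mat"
  assumes A: "A \<in> carrier_mat n n"
  shows "invertible_mat A \<longleftrightarrow> Determinant.det A \<noteq> 0"
proof
  assume "invertible_mat A"
  then obtain B where B: "A * B = 1\<^sub>m n" "B * A = 1\<^sub>m (dim_row B)"
    using A by (auto simp: invertible_mat_def inverts_mat_def)
  \<comment> \<open>\<open>invertible_mat\<close> does not state the dimensions of the inverse; they
    follow by counting the columns of both products.\<close>
  have "dim_col B = n" using arg_cong[OF B(1), of dim_col] by simp
  moreover have "dim_row B = n" using arg_cong[OF B(2), of dim_col] A by simp
  ultimately have "B \<in> carrier_mat n n" by auto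
  then have "Determinant.det A * Determinant.det B = 1"
    using Determinant.det_mult[OF A] B(1) by (metis det_one)
  then show "Determinant.det A \<noteq> 0" by auto
next
  assume d: "Determinant.det A \<noteq> 0"
  let ?B = "inverse (Determinant.det A) \<cdot>\<^sub>m adj_mat A"
  have "A * ?B = 1\<^sub>m n" "?B * A = 1\<^sub>m n"
    using adj_mat[OF A] A d
    by (auto simp: mult_smult_distrib[OF A adj_mat(1)[OF A]] mult_smult_assoc_mat[OF adj_mat(1)[OF A] A])
  then show "invertible_mat A"
    using A adj_mat(1)[OF A] by (auto simp: invertible_mat_def inverts_mat_def)
qed

lemma invertible_mat_iff_kernel:
  fixes A :: "real mat"
  assumes "A \<in> carrier_mat n n"
  shows "invertible_mat A \<longleftrightarrow> (\<forall>v\<in>carrier_vec n. A *\<^sub>v v = 0\<^sub>v n \<longrightarrow> v = 0\<^sub>v n)"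
  unfolding invertible_mat_iff_det[OF assms] det_0_iff_vec_prod_zero[OF assms] by auto

text \<open>Padding \<open>A\<close> with zero rows makes it square. Its row \<open>r\<close> is
  zero, so the transpose kills a unit vector and the determinant vanishes.\<close>

lemma kernel_nontrivial:
  fixes A :: "real mat"
  assumes A: "A \<in> carrier_mat r n" and "r < n"
  obtains v where "v \<in> carrier_vec n" "v \<noteq> 0\<^sub>v n" "A *\<^sub>v v = 0\<^sub>v r"
proof -
  let ?A = "A @\<^sub>r 0\<^sub>m (n - r) n"
  have c: "?A \<in> carrier_mat n n"
    using carrier_append_rows[OF A, of "0\<^sub>m (n - r) n" "n - r"] \<open>r < n\<close> by simp
  have "transpose_mat ?A *\<^sub>v unit_vec n r = 0\<^sub>v n"
  proof (rule eq_vecI)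
    fix j assume "j < dim_vec (0\<^sub>v n)"
    then have j: "j < n" by simp
    have "(transpose_mat ?A *\<^sub>v unit_vec n r) $ j = ?A $$ (r, j)"
      using c j \<open>r < n\<close> by simp
    also have "\<dots> = 0"
      using index_append_rows[OF A, of "0\<^sub>m (n - r) n" "n - r" r j] j \<open>r < n\<close> by simp
    finally show "(transpose_mat ?A *\<^sub>v unit_vec n r) $ j = 0\<^sub>v n $ j" using j by simp
  qed (use c in simp)
  moreover have "unit_vec n r \<noteq> 0\<^sub>v n"
    using \<open>r < n\<close> by (metis index_unit_vec(1) index_zero_vec(1) zero_neq_one)
  ultimately have "Determinant.det (transpose_mat ?A) = 0"
    using c by (subst det_0_iff_vec_prod_zero[of _ n]) (auto intro!: exI[of _ "unit_vec n r"])
  then have "Determinant.det ?A = 0" using Determinant.det_transpose[OF c] by simp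
  then obtain v where v: "v \<in> carrier_vec n" "v \<noteq> 0\<^sub>v n" "?A *\<^sub>v v = 0\<^sub>v n"
    using det_0_iff_vec_prod_zero[OF c] by blast
  have "A *\<^sub>v v @\<^sub>v 0\<^sub>m (n - r) n *\<^sub>v v = 0\<^sub>v n"
    using mat_mult_append[OF A _ v(1), of "0\<^sub>m (n - r) n" "n - r"] v(3) by simp
  then have "(A *\<^sub>v v @\<^sub>v 0\<^sub>m (n - r) n *\<^sub>v v) $ i = 0" if "i < r" for i
    using that \<open>r < n\<close> by simp
  then have "A *\<^sub>v v = 0\<^sub>v r"
    using A \<open>r < n\<close> by (intro eq_vecI) auto
  with v that show thesis by blast
qed

text \<open>A maximal independent set of columns has \<open>r\<close> elements and so is a basis.
  Thus \<open>y\<close>, which is orthogonal to every column, is orthogonal to itself.\<close>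

lemma full_row_rank_transpose_kernel:
  assumes A: "A \<in> carrier_mat r c" and rank: "full_row_rank A"
    and y: "y \<in> carrier_vec r" "transpose_mat A *\<^sub>v y = 0\<^sub>v c"
  shows "y = 0\<^sub>v r"
proof -
  interpret vec_space "TYPE(real)" r .
  obtain S where S: "maximal S (\<lambda>T. T \<subseteq> set (cols A) \<and> lin_indpt T)"
    using maximal_exists_superset[of "set (cols A)" "\<lambda>T. T \<subseteq> set (cols A) \<and> lin_indpt T" "{}"]
      finite_lin_indpt2[of "{}"] by auto
  then have sub: "S \<subseteq> set (cols A)" "lin_indpt S" by (auto simp: maximal_def)
  have carr: "S \<subseteq> carrier_vec r" using sub(1) cols_dim[of A] A by auto
  have fin: "finite S" using sub(1) finite_subset by blast
  have "card S = r"
    using rank_card_indpt[OF A S] rank A by (auto simp: full_row_rank_def mat_rank_def)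
  then have "basis S"
    using dim_li_is_basis[OF fin_dim fin _ sub(2)] carr dim_is_n by auto
  then have "y \<in> span S" using y(1) by (auto simp: basis_def)
  then obtain a where a: "y = lincomb a S"
    using finite_in_span[OF fin] carr by auto
  have orth: "(\<Sum>i = 0..<r. s $ i * y $ i) = 0" if s: "s \<in> S" for s
  proof -
    obtain j where j: "j < c" "s = col A j"
      using s sub(1) A by (auto simp: cols_def)
    have "(transpose_mat A *\<^sub>v y) $ j = 0" using y(2) j(1) by simp
    then show ?thesis using j A y(1) by (simp add: Matrix.scalar_prod_def)
  qed
  have "y \<bullet> y = (\<Sum>i = 0..<r. (\<Sum>s\<in>S. a s * s $ i) * y $ i)"
  proof -
    have "y \<bullet> y = (\<Sum>i = 0..<r. y $ i * y $ i)" using y(1) by (simp add: Matrix.scalar_prod_def)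
    also have "\<dots> = (\<Sum>i = 0..<r. (\<Sum>s\<in>S. a s * s $ i) * y $ i)"
      using lincomb_index[OF _ carr, of _ a] a by (intro sum.cong) auto
    finally show ?thesis .
  qed
  also have "\<dots> = (\<Sum>s\<in>S. a s * (\<Sum>i = 0..<r. s $ i * y $ i))"
    unfolding sum_distrib_left sum_distrib_right by (subst sum.swap) (simp add: mult.assoc)
  also have "\<dots> = 0" using orth by simp
  finally show ?thesis using scalar_prod_self_eq_0[OF y(1)] by simp
qed

text \<open>Over the reals, a kernel vector of the matrix is orthogonal to its rows and can be added as a
  new row.\<close>

lemma row_completion_aux:
  fixes A :: "real mat"
  assumes "A \<in> carrier_mat r (r + d)"
    and "\<And>y. y \<in> carrier_vec r \<Longrightarrow> transpose_mat A *\<^sub>v y = 0\<^sub>v (r + d) \<Longrightarrow> y = 0\<^sub>v r"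
  shows "\<exists>C\<in>carrier_mat d (r + d). invertible_mat (C @\<^sub>r A)"
  using assms
proof (induction d arbitrary: A r)
  case 0
  then have c: "A \<in> carrier_mat r r" by simp
  have "invertible_mat (transpose_mat A)"
    unfolding invertible_mat_iff_kernel[OF transpose_carrier_mat[THEN iffD2, OF c]]
  proof (intro ballI impI)
    show "v = 0\<^sub>v r" if "v \<in> carrier_vec r" "transpose_mat A *\<^sub>v v = 0\<^sub>v r" for v
      by (rule 0(2)) (use that in simp_all)
  qed
  then have "invertible_mat A"
    using invertible_mat_iff_det[OF c] invertible_mat_iff_det[of "transpose_mat A" r]
      Determinant.det_transpose[OF c] c by simp
  moreover have "0\<^sub>m 0 r @\<^sub>r A = A" using 0 zero_append_rows by auto
  ultimately show ?case by (intro bexI[of _ "0\<^sub>m 0 r"]) auto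
next
  case (Suc d)
  let ?n = "r + Suc d"
  obtain w where w: "w \<in> carrier_vec ?n" "w \<noteq> 0\<^sub>v ?n" "A *\<^sub>v w = 0\<^sub>v r"
    using kernel_nontrivial[OF Suc.prems(1)] by auto
  have ww: "w \<bullet> w \<noteq> 0" using scalar_prod_self_eq_0 w by blast
  let ?W = "mat_of_row w"
  have Wc: "?W \<in> carrier_mat 1 ?n" using w(1) mat_of_row_carrier(1) by blast
  have Ac: "?W @\<^sub>r A \<in> carrier_mat (1 + r) ?n" using carrier_append_rows[OF Wc Suc.prems(1)] .
  have "y = 0\<^sub>v (Suc r)" if y: "y \<in> carrier_vec (Suc r)" "transpose_mat (?W @\<^sub>r A) *\<^sub>v y = 0\<^sub>v ?n" for y
  proof -
    let ?z = "Matrix.vec r (\<lambda>i. y $ Suc i)"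
    have ent: "(transpose_mat (?W @\<^sub>r A) *\<^sub>v y) $ j = w $ j * y $ 0 + (transpose_mat A *\<^sub>v ?z) $ j"
      if j: "j < ?n" for j
    proof -
      have "(transpose_mat (?W @\<^sub>r A) *\<^sub>v y) $ j = (\<Sum>i = 0..<Suc r. (?W @\<^sub>r A) $$ (i, j) * y $ i)"
        using Ac j y(1) by (simp add: Matrix.scalar_prod_def)
      also have "\<dots> = (?W @\<^sub>r A) $$ (0, j) * y $ 0 + (\<Sum>i = 0..<r. (?W @\<^sub>r A) $$ (Suc i, j) * y $ Suc i)"
        by (subst sum.atLeast0_lessThan_Suc_shift) simp
      also have "\<dots> = w $ j * y $ 0 + (\<Sum>i = 0..<r. A $$ (i, j) * y $ Suc i)"
        using index_append_rows[OF Wc Suc.prems(1) _ j] j w(1) by simp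
      also have "(\<Sum>i = 0..<r. A $$ (i, j) * y $ Suc i) = (transpose_mat A *\<^sub>v ?z) $ j"
        using Suc.prems(1) j by (simp add: Matrix.scalar_prod_def)
      finally show ?thesis .
    qed
    \<comment> \<open>The rows of \<open>A\<close> are orthogonal to \<open>w\<close>, so pairing
      with \<open>w\<close> leaves only the multiple \<open>w \<bullet> w\<close> of the first entry
      of \<open>y\<close>.\<close>
    have "0 = w \<bullet> (transpose_mat (?W @\<^sub>r A) *\<^sub>v y)" using y(2) w(1) by simp
    also have "\<dots> = (\<Sum>j = 0..<?n. w $ j * (w $ j * y $ 0 + (transpose_mat A *\<^sub>v ?z) $ j))"
      using ent Ac unfolding Matrix.scalar_prod_def by (intro sum.cong) auto
    also have "\<dots> = (w \<bullet> w) * y $ 0 + w \<bullet> (transpose_mat A *\<^sub>v ?z)"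
      using w(1) Suc.prems(1)
      by (simp add: Matrix.scalar_prod_def sum_distrib_right distrib_left sum.distrib mult.assoc
          del: sum.op_ivl_Suc)
    also have "w \<bullet> (transpose_mat A *\<^sub>v ?z) = (A *\<^sub>v w) \<bullet> ?z"
      using transpose_vec_mult_scalar[OF Suc.prems(1) w(1), of ?z] Suc.prems(1) w(1)
      by (metis comm_scalar_prod mult_mat_vec_carrier transpose_carrier_mat vec_carrier)
    also have "\<dots> = 0" using w(3) by simp
    finally have y0: "y $ 0 = 0" using ww by simp
    have "transpose_mat A *\<^sub>v ?z = 0\<^sub>v ?n"
    proof (rule eq_vecI)
      fix j assume "j < dim_vec (0\<^sub>v ?n)"
      then show "(transpose_mat A *\<^sub>v ?z) $ j = 0\<^sub>v ?n $ j" using ent[of j] y(2) y0 by simp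
    qed (use Suc.prems(1) in simp)
    then have "?z = 0\<^sub>v r" using Suc.prems(2) by simp
    then have "y $ Suc i = 0" if "i < r" for i using that by (metis index_vec index_zero_vec(1))
    with y0 have "y $ i = 0" if "i < Suc r" for i using that by (cases i) auto
    then show ?thesis using y(1) by (intro eq_vecI) auto
  qed
  then have "\<exists>C\<in>carrier_mat d (Suc r + d). invertible_mat (C @\<^sub>r (?W @\<^sub>r A))"
    using Ac by (intro Suc.IH) auto
  then obtain C where C: "C \<in> carrier_mat d ?n" "invertible_mat (C @\<^sub>r (?W @\<^sub>r A))" by auto
  then have "invertible_mat ((C @\<^sub>r ?W) @\<^sub>r A)"
    using append_rows_assoc[OF C(1) Wc Suc.prems(1)] by simp
  moreover have "C @\<^sub>r ?W \<in> carrier_mat (Suc d) ?n" using carrier_append_rows[OF C(1) Wc] by simp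
  ultimately show ?case by blast
qed

text \<open>With more rows than columns the transpose would have a nontrivial kernel. The new rows
  \<open>C\<close> stand on top, as \<eta> stands above \<xi> and the free inputs above v.\<close>

lemma full_row_rank_completion:
  assumes A: "A \<in> carrier_mat r n" and rank: "full_row_rank A"
  shows "r \<le> n" and "\<exists>C\<in>carrier_mat (n - r) n. invertible_mat (C @\<^sub>r A)"
proof -
  note ker = full_row_rank_transpose_kernel[OF A rank]
  show le: "r \<le> n"
  proof (rule ccontr)
    assume "\<not> r \<le> n"
    then obtain v where "v \<in> carrier_vec r" "v \<noteq> 0\<^sub>v r" "transpose_mat A *\<^sub>v v = 0\<^sub>v n"
      using kernel_nontrivial[of "transpose_mat A" n r] A by auto
    then show False using ker by blast
  qed
  then have e: "r + (n - r) = n" by simp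
  show "\<exists>C\<in>carrier_mat (n - r) n. invertible_mat (C @\<^sub>r A)"
    by (rule row_completion_aux[of A r "n - r", unfolded e, OF A ker])
qed

section \<open>Smooth vector-valued and matrix-valued functions\<close>

lemma smooth_vec_on_cong:
  "open U \<Longrightarrow> smooth_vec_on U r F \<Longrightarrow> (\<And>x. x \<in> U \<Longrightarrow> F x = G x) \<Longrightarrow> smooth_vec_on U r G"
  unfolding smooth_vec_on_def using smooth_on_cong[of U "\<lambda>x. F x $ _" "\<lambda>x. G x $ _"] by auto

lemma smooth_mat_on_subset: "smooth_mat_on U r c F \<Longrightarrow> V \<subseteq> U \<Longrightarrow> smooth_mat_on V r c F"
  unfolding smooth_mat_on_def using smooth_on_subset by blast

lemma smooth_vec_on_subset: "smooth_vec_on U r F \<Longrightarrow> V \<subseteq> U \<Longrightarrow> smooth_vec_on V r F"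
  unfolding smooth_vec_on_def using smooth_on_subset by blast

lemma smooth_mat_on_const: "A \<in> carrier_mat r c \<Longrightarrow> smooth_mat_on U r c (\<lambda>x. A)"
  by (simp add: smooth_mat_on_def smooth_on_const)

text \<open>The explicit formula \<open>F' i\<close> is required on \<open>U\<close> only: off
  \<open>U\<close> the dimension of \<open>F x\<close> is unknown, so the entry need not be given by
  the formula.\<close>

lemma smooth_vec_onI:
  assumes "open U" "\<And>x. x \<in> U \<Longrightarrow> F x \<in> carrier_vec r"
    and "\<And>i x. i < r \<Longrightarrow> x \<in> U \<Longrightarrow> F x $ i = F' i x" "\<And>i. i < r \<Longrightarrow> smooth_on U (F' i)"
  shows "smooth_vec_on U r F"
  unfolding smooth_vec_on_def
proof (intro conjI allI impI ballI)
  show "smooth_on U (\<lambda>x. F x $ i)" if "i < r" for i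
    using smooth_on_cong[OF assms(1), of "\<lambda>x. F x $ i" "F' i"] assms(3,4) that by auto
qed (use assms(2) in blast)

lemma smooth_mat_onI:
  assumes "open U" "\<And>x. x \<in> U \<Longrightarrow> F x \<in> carrier_mat r c"
    and "\<And>i j x. i < r \<Longrightarrow> j < c \<Longrightarrow> x \<in> U \<Longrightarrow> F x $$ (i, j) = F' i j x"
    and "\<And>i j. i < r \<Longrightarrow> j < c \<Longrightarrow> smooth_on U (F' i j)"
  shows "smooth_mat_on U r c F"
  unfolding smooth_mat_on_def
proof (intro conjI allI impI ballI)
  show "smooth_on U (\<lambda>x. F x $$ (i, j))" if "i < r" "j < c" for i j
    using smooth_on_cong[OF assms(1), of "\<lambda>x. F x $$ (i, j)" "F' i j"] assms(3,4) that by auto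
qed (use assms(2) in blast)

lemma smooth_vec_onD:
  assumes "smooth_vec_on U r F"
  shows "x \<in> U \<Longrightarrow> F x \<in> carrier_vec r" "i < r \<Longrightarrow> smooth_on U (\<lambda>x. F x $ i)"
  using assms by (auto simp: smooth_vec_on_def)

lemma smooth_mat_onD:
  assumes "smooth_mat_on U r c F"
  shows "x \<in> U \<Longrightarrow> F x \<in> carrier_mat r c" "i < r \<Longrightarrow> j < c \<Longrightarrow> smooth_on U (\<lambda>x. F x $$ (i, j))"
  using assms by (auto simp: smooth_mat_on_def)

lemma smooth_mat_on_mult:
  assumes U: "open U" and A: "smooth_mat_on U r k A" and B: "smooth_mat_on U k c B"
  shows "smooth_mat_on U r c (\<lambda>x. A x * B x)"
proof (rule smooth_mat_onI[OF U])
  show "A x * B x \<in> carrier_mat r c" if "x \<in> U" for x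
    using smooth_mat_onD(1)[OF A that] smooth_mat_onD(1)[OF B that] by simp
  show "(A x * B x) $$ (i, j) = (\<Sum>l = 0..<k. A x $$ (i, l) * B x $$ (l, j))"
    if "i < r" "j < c" "x \<in> U" for i j x
    using smooth_mat_onD(1)[OF A that(3)] smooth_mat_onD(1)[OF B that(3)] that
    by (simp add: Matrix.scalar_prod_def)
  show "smooth_on U (\<lambda>x. \<Sum>l = 0..<k. A x $$ (i, l) * B x $$ (l, j))" if "i < r" "j < c" for i j
    using that by (intro smooth_on_sum smooth_on_mult U smooth_mat_onD(2)[OF A] smooth_mat_onD(2)[OF B]) auto
qed

lemma smooth_vec_on_mult:
  assumes U: "open U" and A: "smooth_mat_on U r k A" and B: "smooth_vec_on U k v"
  shows "smooth_vec_on U r (\<lambda>x. A x *\<^sub>v v x)"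
proof (rule smooth_vec_onI[OF U])
  show "A x *\<^sub>v v x \<in> carrier_vec r" if "x \<in> U" for x
    using smooth_mat_onD(1)[OF A that] smooth_vec_onD(1)[OF B that] by simp
  show "(A x *\<^sub>v v x) $ i = (\<Sum>l = 0..<k. A x $$ (i, l) * v x $ l)"
    if "i < r" "x \<in> U" for i x
    using smooth_mat_onD(1)[OF A that(2)] smooth_vec_onD(1)[OF B that(2)] that
    by (simp add: Matrix.scalar_prod_def)
  show "smooth_on U (\<lambda>x. \<Sum>l = 0..<k. A x $$ (i, l) * v x $ l)" if "i < r" for i
    using that by (intro smooth_on_sum smooth_on_mult U smooth_mat_onD(2)[OF A] smooth_vec_onD(2)[OF B]) auto
qed

lemma smooth_vec_on_diff:
  assumes U: "open U" and v: "smooth_vec_on U r v" and w: "smooth_vec_on U r w"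
  shows "smooth_vec_on U r (\<lambda>x. v x - w x)"
proof (rule smooth_vec_onI[OF U])
  show "v x - w x \<in> carrier_vec r" "i < r \<Longrightarrow> (v x - w x) $ i = v x $ i - w x $ i" if "x \<in> U" for i x
    using smooth_vec_onD(1)[OF v that] smooth_vec_onD(1)[OF w that] by auto
  show "smooth_on U (\<lambda>x. v x $ i - w x $ i)" if "i < r" for i
    using that by (intro smooth_on_diff U smooth_vec_onD(2)[OF v] smooth_vec_onD(2)[OF w])
qed

lemma smooth_vec_on_append:
  assumes U: "open U" and v: "smooth_vec_on U r v" and w: "smooth_vec_on U s w"
  shows "smooth_vec_on U (r + s) (\<lambda>x. v x @\<^sub>v w x)"
proof (rule smooth_vec_onI[OF U])
  show "v x @\<^sub>v w x \<in> carrier_vec (r + s)"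
    "i < r + s \<Longrightarrow> (v x @\<^sub>v w x) $ i = (if i < r then v x $ i else w x $ (i - r))" if "x \<in> U" for i x
    using smooth_vec_onD(1)[OF v that] smooth_vec_onD(1)[OF w that] by auto
  show "smooth_on U (\<lambda>x. if i < r then v x $ i else w x $ (i - r))" if "i < r + s" for i
    using that by (cases "i < r") (auto intro: smooth_vec_onD(2)[OF v] smooth_vec_onD(2)[OF w])
qed

lemma smooth_mat_on_append_rows:
  assumes U: "open U" and A: "smooth_mat_on U r c A" and B: "smooth_mat_on U s c B"
  shows "smooth_mat_on U (r + s) c (\<lambda>x. A x @\<^sub>r B x)"
proof (rule smooth_mat_onI[OF U])
  show "A x @\<^sub>r B x \<in> carrier_mat (r + s) c"
    "i < r + s \<Longrightarrow> j < c \<Longrightarrow> (A x @\<^sub>r B x) $$ (i, j) = (if i < r then A x $$ (i, j) else B x $$ (i - r, j))"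
    if "x \<in> U" for i j x
    using index_append_rows[OF smooth_mat_onD(1)[OF A that] smooth_mat_onD(1)[OF B that]]
      carrier_append_rows[OF smooth_mat_onD(1)[OF A that] smooth_mat_onD(1)[OF B that]] by auto
  show "smooth_on U (\<lambda>x. if i < r then A x $$ (i, j) else B x $$ (i - r, j))" if "i < r + s" "j < c" for i j
    using that by (cases "i < r") (auto intro: smooth_mat_onD(2)[OF A] smooth_mat_onD(2)[OF B])
qed

lemma smooth_on_det:
  assumes U: "open U" and A: "smooth_mat_on U r r A"
  shows "smooth_on U (\<lambda>x. Determinant.det (A x))"
proof -
  have "smooth_on U (\<lambda>x. \<Sum>s | s permutes {0..<r}. signof s * (\<Prod>i = 0..<r. A x $$ (i, s i)))"
  proof (intro smooth_on_sum smooth_on_mult smooth_on_prod smooth_on_const U smooth_mat_onD(2)[OF A])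
    fix s i assume "s \<in> {s. s permutes {0..<r}}" "i \<in> {0..<r}"
    then show "i < r" "s i < r" using permutes_in_image[of s "{0..<r}" i] by auto
  qed
  then show ?thesis
    using smooth_on_cong[OF U, of "\<lambda>x. Determinant.det (A x)"] det_def'[OF smooth_mat_onD(1)[OF A]] by auto
qed

text \<open>The entries of the adjugate formula are minors divided by a determinant that does not
  vanish on \<open>U\<close>.\<close>

lemma smooth_inverse_mat:
  assumes U: "open U" and A: "smooth_mat_on U r r A" and inv: "\<And>x. x \<in> U \<Longrightarrow> invertible_mat (A x)"
  obtains B where "smooth_mat_on U r r B" "\<And>x. x \<in> U \<Longrightarrow> B x * A x = 1\<^sub>m r"
proof
  let ?B = "\<lambda>x. inverse (Determinant.det (A x)) \<cdot>\<^sub>m adj_mat (A x)"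
  note Ac = smooth_mat_onD(1)[OF A]
  have det: "Determinant.det (A x) \<noteq> 0" if "x \<in> U" for x
    using inv[OF that] invertible_mat_iff_det[OF Ac[OF that]] by simp
  show "?B x * A x = 1\<^sub>m r" if "x \<in> U" for x
    using adj_mat[OF Ac[OF that]] Ac[OF that] det[OF that]
    by (auto simp: mult_smult_assoc_mat[OF adj_mat(1)[OF Ac[OF that]] Ac[OF that]])
  show "smooth_mat_on U r r ?B"
  proof (rule smooth_mat_onI[OF U])
    show "?B x \<in> carrier_mat r r" if "x \<in> U" for x
      using adj_mat(1)[OF Ac[OF that]] by simp
    show "?B x $$ (i, j) = inverse (Determinant.det (A x)) *
        ((- 1) ^ (j + i) * Determinant.det (mat_delete (A x) j i))" if "i < r" "j < r" "x \<in> U" for i j x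
      using Ac[OF that(3)] that by (simp add: adj_mat_def cofactor_def)
    fix i j assume ij: "i < r" "j < r"
    have "smooth_mat_on U (r - 1) (r - 1) (\<lambda>x. mat_delete (A x) j i)"
    proof (rule smooth_mat_onI[OF U])
      show "mat_delete (A x) j i \<in> carrier_mat (r - 1) (r - 1)" if "x \<in> U" for x
        using mat_delete_carrier[OF Ac[OF that]] .
      \<comment> \<open>Deleting row \<open>j\<close> and column \<open>i\<close> shifts all later
        indices by one.\<close>
      show "mat_delete (A x) j i $$ (k, l) =
          A x $$ (if k < j then k else Suc k, if l < i then l else Suc l)"
        if "k < r - 1" "l < r - 1" "x \<in> U" for k l x
        using Ac[OF that(3)] that by (simp add: mat_delete_def)
      show "smooth_on U (\<lambda>x. A x $$ (if k < j then k else Suc k, if l < i then l else Suc l))"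
        if "k < r - 1" "l < r - 1" for k l
        using that by (intro smooth_mat_onD(2)[OF A]) auto
    qed
    then show "smooth_on U (\<lambda>x. inverse (Determinant.det (A x)) *
        ((- 1) ^ (j + i) * Determinant.det (mat_delete (A x) j i)))"
      by (intro smooth_on_mult smooth_on_inverse smooth_on_const smooth_on_det[OF U A] smooth_on_det[OF U]
          U det)
  qed
qed

text \<open>The determinant is continuous, so it stays nonzero near \<open>x0\<close>.\<close>

lemma invertible_mat_open_nbhd:
  assumes U: "open U" and A: "smooth_mat_on U r r A" and "x0 \<in> U" "invertible_mat (A x0)"
  obtains V where "open V" "x0 \<in> V" "V \<subseteq> U" "\<And>x. x \<in> V \<Longrightarrow> invertible_mat (A x)"
proof
  let ?V = "{x \<in> U. Determinant.det (A x) \<in> - {0}}"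
  have "continuous_on U (\<lambda>x. Determinant.det (A x))"
    by (rule smooth_on_continuous_on[OF smooth_on_det[OF U A]])
  then have "open (U \<inter> (\<lambda>x. Determinant.det (A x)) -` (- {0}))"
    using U by (intro continuous_open_preimage) auto
  then show "open ?V" by (simp add: vimage_def Int_def)
  show "x0 \<in> ?V" using assms invertible_mat_iff_det[OF smooth_mat_onD(1)[OF A]] by simp
  show "invertible_mat (A x)" if "x \<in> ?V" for x
    using that invertible_mat_iff_det[OF smooth_mat_onD(1)[OF A]] by simp
qed auto

section \<open>Jacobians\<close>

lemma to_nat_on_UNIV_less: "to_nat_on (UNIV :: 'n::finite set) i < CARD('n)"
  using to_nat_on_finite[of "UNIV :: 'n set"] by (auto simp: bij_betw_def)

lemma to_nat_on_UNIV_eq_iff: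
  assumes "j < CARD('n::finite)"
  shows "to_nat_on (UNIV :: 'n set) i = j \<longleftrightarrow> i = from_nat_into UNIV j"
proof -
  have "j \<in> to_nat_on (UNIV :: 'n set) ` UNIV"
    using to_nat_on_finite[of "UNIV :: 'n set"] assms by (simp add: bij_betw_def)
  then show ?thesis
    using eq_from_nat_into_iff[of "UNIV :: 'n set" i j] by (auto simp: countable_finite)
qed

text \<open>The inverse of \<open>vec_to_state\<close> on vectors of dimension
  \<open>CARD('n)\<close>, in the numbering used by \<open>jac\<close>. It allows linear coordinates
  to be written as matrix products.\<close>

definition state_to_vec :: "real^'n \<Rightarrow> real Matrix.vec" where
  "state_to_vec w = Matrix.vec CARD('n) (\<lambda>j. vec_nth w (from_nat_into UNIV j))"

lemma state_to_vec_carrier [simp]: "state_to_vec (w :: real^'n) \<in> carrier_vec CARD('n)"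
  by (simp add: state_to_vec_def)

lemma vec_to_state_to_vec [simp]: "vec_to_state (state_to_vec w) = w"
  by (simp add: vec_to_state_def state_to_vec_def to_nat_on_UNIV_less Finite_Cartesian_Product.vec_eq_iff)

lemma state_to_vec_to_state:
  assumes "v \<in> carrier_vec CARD('n)"
  shows "state_to_vec (vec_to_state v :: real^'n) = v"
proof (rule Matrix.eq_vecI)
  fix j assume "j < dim_vec v"
  then have "j < CARD('n)" using assms by simp
  then have "to_nat_on (UNIV :: 'n set) (from_nat_into UNIV j) = j"
    by (simp add: to_nat_on_UNIV_eq_iff)
  then show "state_to_vec (vec_to_state v :: real^'n) $ j = v $ j"
    using \<open>j < CARD('n)\<close> by (simp add: state_to_vec_def vec_to_state_def)
qed (use assms in \<open>simp add: state_to_vec_def\<close>)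

lemma vec_to_state_eq_sum:
  "(vec_to_state v :: real^'n) = (\<Sum>j = 0..<CARD('n). v $ j *\<^sub>R axis (from_nat_into UNIV j) 1)"
proof -
  have "(\<Sum>j = 0..<CARD('n). v $ j * vec_nth (axis (from_nat_into UNIV j) 1) i) = v $ to_nat_on UNIV i"
    for i :: 'n
  proof -
    have "(\<Sum>j = 0..<CARD('n). v $ j * vec_nth (axis (from_nat_into UNIV j) 1) i)
        = (\<Sum>j = 0..<CARD('n). if to_nat_on UNIV i = j then v $ j else 0)"
      by (intro sum.cong) (auto simp: axis_def to_nat_on_UNIV_eq_iff)
    also have "\<dots> = v $ to_nat_on UNIV i"
      by (subst sum.delta') (auto simp: to_nat_on_UNIV_less)
    finally show ?thesis .
  qed
  then show ?thesis
    by (simp add: vec_to_state_def Finite_Cartesian_Product.vec_eq_iff)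
qed

lemma bounded_linear_state_to_vec:
  assumes "j < CARD('n)"
  shows "bounded_linear (\<lambda>w :: real^'n. state_to_vec w $ j)"
  using assms bounded_linear_vec_nth by (simp add: state_to_vec_def)

section \<open>Jacobian matrices\<close>

lemma jac_carrier: "F x \<in> carrier_vec r \<Longrightarrow> jac F x \<in> carrier_mat r CARD('n)" for x :: "real^'n"
  by (auto simp: jac_def)

lemma smooth_mat_on_jac:
  fixes U :: "(real^'n) set"
  assumes "open U" "smooth_vec_on U r F"
  shows "smooth_mat_on U r CARD('n) (jac F)"
proof (rule smooth_mat_onI[OF assms(1)])
  show "jac F x \<in> carrier_mat r CARD('n)" if "x \<in> U" for x
    using jac_carrier smooth_vec_onD(1)[OF assms(2) that] by blast
  show "jac F x $$ (i, j) = frechet_derivative (\<lambda>z. F z $ i) (at x) (axis (from_nat_into UNIV j) 1)"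
    if "i < r" "j < CARD('n)" "x \<in> U" for i j x
    using that smooth_vec_onD(1)[OF assms(2) that(3)] by (simp add: jac_def)
  show "smooth_on U (\<lambda>x. frechet_derivative (\<lambda>z. F z $ i) (at x) (axis (from_nat_into UNIV j) 1))"
    if "i < r" for i j
    by (rule smooth_on_derivative[OF smooth_vec_onD(2)[OF assms(2) that]])
qed

text \<open>Expand the direction in the coordinate axes and use linearity. Functions with a common
  component can then be compared row by row through their derivatives.\<close>

lemma jac_mult_vec_index:
  assumes F: "smooth_vec_on U r F" and "x \<in> U" "i < r" and v: "v \<in> carrier_vec CARD('n)"
  shows "(jac F x *\<^sub>v v) $ i = frechet_derivative (\<lambda>z. F z $ i) (at x) (vec_to_state v :: real^'n)"
proof -
  let ?D = "frechet_derivative (\<lambda>z. F z $ i) (at x)"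
  have lin: "linear ?D"
    using smooth_on_has_derivative[OF smooth_vec_onD(2)[OF F \<open>i < r\<close>] \<open>x \<in> U\<close>] has_derivative_linear by blast
  have "?D (vec_to_state v) = (\<Sum>j = 0..<CARD('n). v $ j * ?D (axis (from_nat_into UNIV j) 1))"
    unfolding vec_to_state_eq_sum by (simp add: linear_sum[OF lin] linear_cmul[OF lin])
  then show ?thesis
    using smooth_vec_onD(1)[OF F \<open>x \<in> U\<close>] \<open>i < r\<close> v
    by (simp add: jac_def Matrix.scalar_prod_def mult.commute)
qed

lemma jac_cong:
  assumes "open U" "x \<in> U" "\<And>z. z \<in> U \<Longrightarrow> F z = G z"
  shows "jac F x = jac G x"
  using assms(3)[OF assms(2)] frechet_derivative_cong_open[OF assms(1,2), of "\<lambda>z. F z $ _" "\<lambda>z. G z $ _"] assms(3)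
  by (auto simp: jac_def intro!: eq_matI)

lemma jac_mult_const:
  fixes U :: "(real^'n) set"
  assumes U: "open U" "x \<in> U" and F: "smooth_vec_on U c F" and M: "M \<in> carrier_mat r c"
  shows "jac (\<lambda>z. M *\<^sub>v F z) x = M * jac F x"
proof (rule eq_matI)
  have Fx: "F x \<in> carrier_vec c" using smooth_vec_onD(1)[OF F U(2)] .
  fix i j assume "i < dim_row (M * jac F x)" "j < dim_col (M * jac F x)"
  then have ij: "i < r" "j < CARD('n)" using M jac_carrier[of F x c] Fx by (auto simp: jac_def)
  have der: "((\<lambda>z. \<Sum>k = 0..<c. M $$ (i, k) * F z $ k) has_derivative
      (\<lambda>w. \<Sum>k = 0..<c. M $$ (i, k) * frechet_derivative (\<lambda>z. F z $ k) (at x) w)) (at x)"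
    by (intro has_derivative_sum has_derivative_mult_right
        smooth_on_has_derivative[OF smooth_vec_onD(2)[OF F] U(2)]) simp
  have cong: "frechet_derivative (\<lambda>z. (M *\<^sub>v F z) $ i) (at x)
      = frechet_derivative (\<lambda>z. \<Sum>k = 0..<c. M $$ (i, k) * F z $ k) (at x)"
  proof (rule frechet_derivative_cong_open[OF U])
    show "(M *\<^sub>v F z) $ i = (\<Sum>k = 0..<c. M $$ (i, k) * F z $ k)" if "z \<in> U" for z
      using M ij(1) smooth_vec_onD(1)[OF F that] by (simp add: Matrix.scalar_prod_def)
  qed
  have "frechet_derivative (\<lambda>z. (M *\<^sub>v F z) $ i) (at x)
      = (\<lambda>w. \<Sum>k = 0..<c. M $$ (i, k) * frechet_derivative (\<lambda>z. F z $ k) (at x) w)"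
    unfolding cong by (rule frechet_derivative_at[OF der, symmetric])
  then show "jac (\<lambda>z. M *\<^sub>v F z) x $$ (i, j) = (M * jac F x) $$ (i, j)"
    using ij M Fx by (simp add: jac_def Matrix.scalar_prod_def)
qed (use M in \<open>auto simp: jac_def\<close>)

lemma jac_append:
  fixes U :: "(real^'n) set"
  assumes U: "open U" "x \<in> U" and F: "smooth_vec_on U r F" and G: "smooth_vec_on U s G"
  shows "jac (\<lambda>z. F z @\<^sub>v G z) x = jac F x @\<^sub>r jac G x"
proof (rule eq_matI)
  note Fc = smooth_vec_onD(1)[OF F] and Gc = smooth_vec_onD(1)[OF G]
  have JF: "jac F x \<in> carrier_mat r CARD('n)" and JG: "jac G x \<in> carrier_mat s CARD('n)"
    using jac_carrier Fc[OF U(2)] Gc[OF U(2)] by auto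
  have dims: "jac F x @\<^sub>r jac G x \<in> carrier_mat (r + s) CARD('n)"
    "F x @\<^sub>v G x \<in> carrier_vec (r + s)"
    using carrier_append_rows[OF JF JG] Fc[OF U(2)] Gc[OF U(2)] by auto
  show "dim_row (jac (\<lambda>z. F z @\<^sub>v G z) x) = dim_row (jac F x @\<^sub>r jac G x)"
    using carrier_matD(1)[OF dims(1)] carrier_vecD[OF dims(2)]
    by (simp only: jac_def[of "\<lambda>z. F z @\<^sub>v G z"] dim_row_mat)
  show "dim_col (jac (\<lambda>z. F z @\<^sub>v G z) x) = dim_col (jac F x @\<^sub>r jac G x)"
    using carrier_matD(2)[OF dims(1)] by (simp only: jac_def[of "\<lambda>z. F z @\<^sub>v G z"] dim_col_mat)
  fix i j assume "i < dim_row (jac F x @\<^sub>r jac G x)" "j < dim_col (jac F x @\<^sub>r jac G x)"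
  then have ij: "i < r + s" "j < CARD('n)" using dims by auto
  have "frechet_derivative (\<lambda>z. (F z @\<^sub>v G z) $ i) (at x) =
      frechet_derivative (\<lambda>z. if i < r then F z $ i else G z $ (i - r)) (at x)"
  proof (rule frechet_derivative_cong_open[OF U])
    show "(F z @\<^sub>v G z) $ i = (if i < r then F z $ i else G z $ (i - r))" if "z \<in> U" for z
      using Fc[OF that] Gc[OF that] ij(1) by simp
  qed
  then show "jac (\<lambda>z. F z @\<^sub>v G z) x $$ (i, j) = (jac F x @\<^sub>r jac G x) $$ (i, j)"
    using index_append_rows[OF JF JG ij] ij dims(2) Fc[OF U(2)] Gc[OF U(2)]
    by (cases "i < r") (auto simp: jac_def)
qed

section \<open>Stacked vector functions and the kernels of their Jacobians\<close>

lemma col_vec_Nil: "col_vec [] = 0\<^sub>v 0"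
  and col_vec_Cons: "col_vec (v # vs) = v @\<^sub>v col_vec vs"
  by (simp_all add: col_vec_def)

lemma append_vec_zero_right: "v @\<^sub>v 0\<^sub>v 0 = v"
  by (intro Matrix.eq_vecI) auto

lemma append_vec_assoc: "(u @\<^sub>v v) @\<^sub>v w = u @\<^sub>v (v @\<^sub>v w)"
  by (intro Matrix.eq_vecI) auto

lemma col_vec_append: "col_vec (vs @ ws) = col_vec vs @\<^sub>v col_vec ws"
proof (induction vs)
  case Nil
  show ?case by (intro Matrix.eq_vecI) (auto simp: col_vec_Nil)
qed (simp add: col_vec_Cons append_vec_assoc)

lemma smooth_vec_on_col_vec:
  assumes "open U" "\<And>k. k \<in> set ks \<Longrightarrow> smooth_vec_on U (d k) (F k)"
  shows "smooth_vec_on U (\<Sum>k\<leftarrow>ks. d k) (\<lambda>x. col_vec (map (\<lambda>k. F k x) ks))"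
  using assms(2)
proof (induction ks)
  case Nil
  then show ?case by (simp add: col_vec_Nil smooth_vec_on_def)
next
  case (Cons k ks)
  then show ?case using smooth_vec_on_append[OF assms(1), of "d k" "F k"] by (simp add: col_vec_Cons)
qed

lemma append_vec_eq_zero_iff:
  fixes v w :: "real Matrix.vec"
  assumes "v \<in> carrier_vec r" "w \<in> carrier_vec s"
  shows "v @\<^sub>v w = 0\<^sub>v (r + s) \<longleftrightarrow> v = 0\<^sub>v r \<and> w = 0\<^sub>v s"
proof -
  have "(0\<^sub>v (r + s) :: real Matrix.vec) = 0\<^sub>v r @\<^sub>v 0\<^sub>v s" by (intro Matrix.eq_vecI) auto
  then show ?thesis by (simp only:) (rule append_vec_eq[OF assms(1)], simp)
qed

lemma jac_append_kernel:
  fixes U :: "(real^'n) set"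
  assumes U: "open U" "x \<in> U" and F: "smooth_vec_on U r F" and G: "smooth_vec_on U s G"
    and v: "v \<in> carrier_vec CARD('n)"
  shows "jac (\<lambda>z. F z @\<^sub>v G z) x *\<^sub>v v = 0\<^sub>v (r + s) \<longleftrightarrow>
    jac F x *\<^sub>v v = 0\<^sub>v r \<and> jac G x *\<^sub>v v = 0\<^sub>v s"
proof -
  have JF: "jac F x \<in> carrier_mat r CARD('n)" and JG: "jac G x \<in> carrier_mat s CARD('n)"
    using jac_carrier smooth_vec_onD(1)[OF F U(2)] smooth_vec_onD(1)[OF G U(2)] by auto
  show ?thesis
    unfolding jac_append[OF U F G] mat_mult_append[OF JF JG v]
    using JF JG v by (intro append_vec_eq_zero_iff) auto
qed

text \<open>The right-hand side does not see the order of the blocks. This permits the comparison of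
  \<open>Phi_d\<close>, stacked block by block, with the coordinates \<xi>, stacked chain by
  chain.\<close>

lemma jac_col_vec_kernel:
  fixes U :: "(real^'n) set"
  assumes U: "open U" "x \<in> U" and "\<And>k. k \<in> set ks \<Longrightarrow> smooth_vec_on U (d k) (F k)"
    and v: "v \<in> carrier_vec CARD('n)"
  shows "jac (\<lambda>z. col_vec (map (\<lambda>k. F k z) ks)) x *\<^sub>v v = 0\<^sub>v (\<Sum>k\<leftarrow>ks. d k) \<longleftrightarrow>
    (\<forall>k\<in>set ks. jac (F k) x *\<^sub>v v = 0\<^sub>v (d k))"
  using assms(3)
proof (induction ks)
  case Nil
  then show ?case by (auto simp: col_vec_Nil jac_def intro!: Matrix.eq_vecI)
next
  case (Cons k ks)
  have "smooth_vec_on U (\<Sum>k\<leftarrow>ks. d k) (\<lambda>x. col_vec (map (\<lambda>k. F k x) ks))"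
    using Cons.prems by (intro smooth_vec_on_col_vec[OF U(1)]) auto
  from jac_append_kernel[OF U _ this v, of "d k" "F k"] show ?case
    using Cons by (simp add: col_vec_Cons)
qed

section \<open>The derivatives of the outputs of the algorithm\<close>

lemma append_rows_mult:
  fixes A B C :: "real mat"
  assumes A: "A \<in> carrier_mat r k" and B: "B \<in> carrier_mat s k" and C: "C \<in> carrier_mat k c"
  shows "(A @\<^sub>r B) * C = A * C @\<^sub>r B * C"
proof (rule eq_matI)
  have AB: "A @\<^sub>r B \<in> carrier_mat (r + s) k" using carrier_append_rows[OF A B] .
  have AC: "A * C \<in> carrier_mat r c" and BC: "B * C \<in> carrier_mat s c" using A B C by auto
  note d = carrier_append_rows[OF AC BC]
  show "dim_row ((A @\<^sub>r B) * C) = dim_row (A * C @\<^sub>r B * C)"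
    "dim_col ((A @\<^sub>r B) * C) = dim_col (A * C @\<^sub>r B * C)"
    using AB C carrier_matD[OF d] by simp_all
  fix i j assume "i < dim_row (A * C @\<^sub>r B * C)" "j < dim_col (A * C @\<^sub>r B * C)"
  then have ij: "i < r + s" "j < c" using carrier_matD[OF d] by auto
  have "((A @\<^sub>r B) * C) $$ (i, j) = (\<Sum>l = 0..<k. (A @\<^sub>r B) $$ (i, l) * C $$ (l, j))"
    using AB C ij by (simp add: Matrix.scalar_prod_def)
  also have "\<dots> = (if i < r then (A * C) $$ (i, j) else (B * C) $$ (i - r, j))"
    using index_append_rows[OF A B ij(1)] A B C ij by (auto simp: Matrix.scalar_prod_def intro!: sum.cong)
  finally show "((A @\<^sub>r B) * C) $$ (i, j) = (A * C @\<^sub>r B * C) $$ (i, j)"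
    using index_append_rows[OF AC BC ij] by simp
qed

lemma mult_mat_vec_index:
  assumes "A \<in> carrier_mat r c" "v \<in> carrier_vec c" "i < r"
  shows "(A *\<^sub>v v) $ i = (\<Sum>k = 0..<c. A $$ (i, k) * v $ k)"
  using assms by (simp add: Matrix.scalar_prod_def)

section \<open>Rows, blocks and the list of chain lengths\<close>

lemma q_list_Suc: "q_list \<rho> (Suc k) = q_list \<rho> k @ replicate (\<rho> (Suc k) - \<rho> k) (Suc k)"
  by (simp add: q_list_def)

lemma sum_list_q_list: "sum_list (q_list \<rho> k) = n_upto \<rho> k"
  by (induction k) (simp_all add: q_list_Suc n_upto_def sum_list_replicate, simp_all add: q_list_def)

text \<open>The index combinatorics uses only the monotonicity of \<rho>, which has to be derived
  from regularity, since differences of natural numbers are truncated.\<close>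

locale rank_sequence =
  fixes \<rho> :: "nat \<Rightarrow> nat" and K :: nat
  assumes rho_0: "\<rho> 0 = 0" and rho_step: "\<And>k. k \<in> {1..K} \<Longrightarrow> \<rho> (k - 1) \<le> \<rho> k"
begin

abbreviation "q \<equiv> q_list \<rho> K"

text \<open>The row \<open>i\<close> of \<open>\<Omega>\<^sub>K\<close> lies in the block \<open>q ! i\<close>, at the position \<open>pos i\<close> of this block.\<close>

definition pos :: "nat \<Rightarrow> nat" where "pos i = i - \<rho> (q ! i - 1)"

lemma rho_mono: "i \<le> j \<Longrightarrow> j \<le> K \<Longrightarrow> \<rho> i \<le> \<rho> j"
proof (induction j)
  case (Suc j)
  then show ?case using rho_step[of "Suc j"] by (cases "i = Suc j") auto
qed simp

lemma q_list_nth: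
  assumes "k \<le> K" "i < \<rho> k"
  shows "q ! i \<in> {1..k}" "\<rho> (q ! i - 1) \<le> i" "i < \<rho> (q ! i)"
proof -
  have "length (q_list \<rho> k) = \<rho> k \<and> (\<forall>i<\<rho> k. q_list \<rho> k ! i \<in> {1..k} \<and>
      \<rho> (q_list \<rho> k ! i - 1) \<le> i \<and> i < \<rho> (q_list \<rho> k ! i))" if "k \<le> K" for k
    using that
  proof (induction k)
    case 0
    then show ?case by (simp add: q_list_def rho_0)
  next
    case (Suc k)
    then show ?case using rho_step[of "Suc k"] by (auto simp: q_list_Suc nth_append)
  qed
  \<comment> \<open>Later steps only append to the list, so \<open>q_list \<rho> k\<close> is a
    prefix of \<open>q\<close>.\<close>
  moreover have "q ! i = q_list \<rho> k ! i"
  proof -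
    have "j \<le> K \<Longrightarrow> k \<le> j \<Longrightarrow> q_list \<rho> j ! i = q_list \<rho> k ! i" for j
    proof (induction j)
      case (Suc j)
      show ?case
      proof (cases "k = Suc j")
        case False
        then have "i < length (q_list \<rho> j)"
          using Suc.prems calculation[of j] rho_mono[of k j] assms by auto
        then show ?thesis using Suc False by (simp add: q_list_Suc nth_append)
      qed simp
    qed simp
    then show ?thesis using assms by blast
  qed
  ultimately show "q ! i \<in> {1..k}" "\<rho> (q ! i - 1) \<le> i" "i < \<rho> (q ! i)"
    using assms by auto
qed

text \<open>By monotonicity of \<rho> the index intervals from \<open>\<rho> (c - 1)\<close> to
  \<open>\<rho> c\<close> are disjoint, and \<open>i\<close> lies in the one belonging to
  \<open>q ! i\<close>.\<close>

lemma q_list_eqI: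
  assumes "c \<in> {1..K}" "\<rho> (c - 1) \<le> i" "i < \<rho> c"
  shows "q ! i = c"
proof -
  have "i < \<rho> K" using assms rho_mono[of c K] by auto
  note nth = q_list_nth[OF order_refl this]
  have "\<rho> (q ! i) \<le> \<rho> (c - 1)" if "q ! i < c" using that assms by (intro rho_mono) auto
  then have "\<not> q ! i < c" using nth assms by auto
  moreover have "\<rho> c \<le> \<rho> (q ! i - 1)" if "c < q ! i" using that nth by (intro rho_mono) auto
  then have "\<not> c < q ! i" using nth assms by auto
  ultimately show ?thesis by simp
qed

lemma length_q: "length q = \<rho> K"
proof -
  have "k \<le> K \<Longrightarrow> length (q_list \<rho> k) = \<rho> k" for k
  proof (induction k)
    case 0
    then show ?case by (simp add: q_list_def rho_0)
  next
    case (Suc k)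
    then show ?case using rho_step[of "Suc k"] by (simp add: q_list_Suc)
  qed
  then show ?thesis by simp
qed

lemma pos_less: "i < \<rho> K \<Longrightarrow> pos i < \<rho> (q ! i) - \<rho> (q ! i - 1)"
  using q_list_nth[of K i] by (auto simp: pos_def)

lemma q_list_block:
  assumes "c \<in> {1..K}" "s < \<rho> c - \<rho> (c - 1)"
  shows "\<rho> (c - 1) + s < \<rho> c" "q ! (\<rho> (c - 1) + s) = c" "pos (\<rho> (c - 1) + s) = s"
proof -
  show "\<rho> (c - 1) + s < \<rho> c" using assms by simp
  then show "q ! (\<rho> (c - 1) + s) = c" using assms by (intro q_list_eqI) auto
  then show "pos (\<rho> (c - 1) + s) = s" by (simp add: pos_def)
qed

text \<open>Passes from the block sums of the algorithm to the sums over single rows in the normal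
  form: block \<open>l\<close> and position \<open>s\<close> become the row
  \<open>\<rho> (l - 1) + s\<close>.\<close>

lemma sum_blocks:
  fixes F :: "nat \<Rightarrow> nat \<Rightarrow> real"
  assumes "k \<le> K"
  shows "(\<Sum>l = 1..k. \<Sum>s = 0..<\<rho> l - \<rho> (l - 1). F l s) = (\<Sum>i = 0..<\<rho> k. F (q ! i) (pos i))"
  using assms
proof (induction k)
  case (Suc k)
  have le: "\<rho> k \<le> \<rho> (Suc k)" using rho_step[of "Suc k"] Suc.prems by simp
  have "(\<Sum>i = 0..<\<rho> (Suc k). F (q ! i) (pos i))
      = (\<Sum>i = 0..<\<rho> k. F (q ! i) (pos i)) + (\<Sum>i = \<rho> k..<\<rho> (Suc k). F (q ! i) (pos i))"
    using le by (simp add: sum.atLeastLessThan_concat)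
  also have "(\<Sum>i = \<rho> k..<\<rho> (Suc k). F (q ! i) (pos i))
      = (\<Sum>s = 0..<\<rho> (Suc k) - \<rho> k. F (q ! (\<rho> k + s)) (pos (\<rho> k + s)))"
    by (subst sum.atLeastLessThan_shift_0) (simp add: add.commute)
  also have "\<dots> = (\<Sum>s = 0..<\<rho> (Suc k) - \<rho> k. F (Suc k) s)"
    using q_list_block[of "Suc k"] Suc.prems by (intro sum.cong) auto
  finally show ?case using Suc by simp
qed (simp add: rho_0)

end

section \<open>Smoothness and ranks along a run of the algorithm\<close>

locale regular_system =
  fixes U :: "(real^'n) set"
    and f h :: "real^'n \<Rightarrow> real Matrix.vec" and g :: "real^'n \<Rightarrow> real mat"
    and m p K :: nat
    and \<rho> :: "nat \<Rightarrow> nat" and R S :: "nat \<Rightarrow> real mat"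
    and P :: "nat \<Rightarrow> nat \<Rightarrow> real^'n \<Rightarrow> real mat" and \<Theta> :: "nat \<Rightarrow> real^'n \<Rightarrow> real Matrix.vec"
  assumes U: "open U" "0 \<in> U"
    and f: "smooth_vec_on U CARD('n) f"
    and g: "smooth_mat_on U CARD('n) m g"
    and h: "smooth_vec_on U p h"
    and run: "zero_structure_run m p U f g h \<rho> R S P \<Theta> K"
    and regular: "regular p U g \<rho> R \<Theta> K"
begin

abbreviation "RT l \<equiv> \<lambda>z. R l *\<^sub>v \<Theta> (l - 1) z"
abbreviation "ST k \<equiv> \<lambda>z. S k *\<^sub>v \<Theta> (k - 1) z"

lemma step: "k \<in> {1..K} \<Longrightarrow> zero_structure_step p U f g \<rho> R S P \<Theta> k"
  and rho_0: "\<rho> 0 = 0" and Theta_0: "\<Theta> 0 = h" and K: "1 \<le> K"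
  using run by (auto simp: zero_structure_run_def)

lemma R_carrier: "k \<in> {1..K} \<Longrightarrow> R k \<in> carrier_mat (\<rho> k - \<rho> (k - 1)) (p - \<rho> (k - 1))"
  using regular by (auto simp: regular_def assumption_A_def)

lemma S_carrier: "k \<in> {1..K} \<Longrightarrow> S k \<in> carrier_mat (p - \<rho> k) (p - \<rho> (k - 1))"
  using step by (auto simp: zero_structure_step_def)

lemma RS_invertible: "k \<in> {1..K} \<Longrightarrow> invertible_mat (R k @\<^sub>r S k)"
  using step by (auto simp: zero_structure_step_def)

lemma P_smooth: "k \<in> {1..K} \<Longrightarrow> l \<in> {1..k} \<Longrightarrow> smooth_mat_on U (p - \<rho> k) (\<rho> l - \<rho> (l - 1)) (P k l)"
  using step by (auto simp: zero_structure_step_def)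

lemma smooth_const_mult:
  "M \<in> carrier_mat r c \<Longrightarrow> smooth_vec_on U c F \<Longrightarrow> smooth_vec_on U r (\<lambda>x. M *\<^sub>v F x)"
  using smooth_vec_on_mult[OF U(1) smooth_mat_on_const] .

lemma Lie_f_smooth: "smooth_vec_on U r F \<Longrightarrow> smooth_vec_on U r (Lie_f f F)"
  unfolding Lie_f_def[abs_def] by (rule smooth_vec_on_mult[OF U(1) smooth_mat_on_jac[OF U(1)] f])

lemma Lie_g_smooth: "smooth_vec_on U r F \<Longrightarrow> smooth_mat_on U r m (Lie_g g F)"
  unfolding Lie_g_def[abs_def] by (rule smooth_mat_on_mult[OF U(1) smooth_mat_on_jac[OF U(1)] g])

text \<open>Course-of-values induction, because \<open>\<Theta> k\<close> involves the functions of
  all earlier steps. Its formula holds on \<open>U\<close> only, hence the final passage by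
  congruence.\<close>

lemma Theta_smooth: "k \<le> K \<Longrightarrow> smooth_vec_on U (p - \<rho> k) (\<Theta> k)"
proof (induction k rule: less_induct)
  case (less k)
  show ?case
  proof (cases "k = 0")
    case True
    then show ?thesis using h Theta_0 rho_0 by simp
  next
    case False
    then have k: "k \<in> {1..K}" using less.prems by simp
    have IH: "smooth_vec_on U (p - \<rho> (l - 1)) (\<Theta> (l - 1))" if "l \<in> {1..k}" for l
      using less that by auto
    have S: "smooth_vec_on U (p - \<rho> k) (Lie_f f (ST k))"
      using False by (intro Lie_f_smooth smooth_const_mult[OF S_carrier[OF k]] IH) simp
    have Psum: "smooth_vec_on U (p - \<rho> k) (\<lambda>x. P k l x *\<^sub>v Lie_f f (RT l) x)" if l: "l \<in> {1..k}" for l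
      using l k by (intro smooth_vec_on_mult[OF U(1) P_smooth] Lie_f_smooth smooth_const_mult[OF R_carrier] IH) auto
    have "smooth_vec_on U (p - \<rho> k)
      (\<lambda>x. Matrix.vec (p - \<rho> k) (\<lambda>i. \<Sum>l=1..k. (P k l x *\<^sub>v Lie_f f (RT l) x) $ i))"
    proof (rule smooth_vec_onI[OF U(1)])
      show "smooth_on U (\<lambda>x. \<Sum>l=1..k. (P k l x *\<^sub>v Lie_f f (RT l) x) $ i)" if "i < p - \<rho> k" for i
        by (intro smooth_on_sum U smooth_vec_onD(2)[OF Psum] that)
    qed auto
    from smooth_vec_on_diff[OF U(1) S this] show ?thesis
      by (rule smooth_vec_on_cong[OF U(1)]) (use step[OF k] in \<open>simp add: zero_structure_step_def\<close>)
  qed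
qed

lemma RT_smooth: "k \<in> {1..K} \<Longrightarrow> smooth_vec_on U (\<rho> k - \<rho> (k - 1)) (RT k)"
  by (rule smooth_const_mult[OF R_carrier Theta_smooth]) auto

lemma ST_smooth: "k \<in> {1..K} \<Longrightarrow> smooth_vec_on U (p - \<rho> k) (ST k)"
  by (rule smooth_const_mult[OF S_carrier Theta_smooth]) auto

lemma Omega_Suc: "Omega R \<Theta> (Suc k) = (\<lambda>x. Omega R \<Theta> k x @\<^sub>v RT (Suc k) x)"
proof
  have "[1..<Suc (Suc k)] = [1..<Suc k] @ [Suc k]" by simp
  then show "Omega R \<Theta> (Suc k) x = Omega R \<Theta> k x @\<^sub>v RT (Suc k) x" for x
    by (simp only: Omega_def map_append col_vec_append list.map col_vec_Cons col_vec_Nil append_vec_zero_right)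
qed

text \<open>The dimension stays a sum of truncated differences until \<rho> is known to be
  monotone.\<close>

lemma Omega_smooth_sum:
  "k \<le> K \<Longrightarrow> smooth_vec_on U (\<Sum>l\<leftarrow>[1..<Suc k]. \<rho> l - \<rho> (l - 1)) (Omega R \<Theta> k)"
  unfolding Omega_def[abs_def] by (rule smooth_vec_on_col_vec[OF U(1)]) (rule RT_smooth, auto)

lemma Lie_g_append:
  assumes F: "smooth_vec_on U r F" and G: "smooth_vec_on U s G" and x: "x \<in> U"
  shows "Lie_g g (\<lambda>z. F z @\<^sub>v G z) x = Lie_g g F x @\<^sub>r Lie_g g G x"
  unfolding Lie_g_def jac_append[OF U(1) x F G]
  using smooth_vec_onD(1)[OF F x] smooth_vec_onD(1)[OF G x] smooth_mat_onD(1)[OF g x]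
  by (intro append_rows_mult[OF jac_carrier jac_carrier])

text \<open>The stacked matrix in \<open>assumption_A\<close> is the product of the Jacobian of the
  stacked function \<open>Omega R \<Theta> (Suc k)\<close> with \<open>g\<close>.\<close>

lemma full_rank_step:
  assumes k: "Suc k \<le> K" and x: "x \<in> U"
  shows "full_row_rank (Lie_g g (Omega R \<Theta> (Suc k)) x)" "mat_rank (Lie_g g (Omega R \<Theta> (Suc k)) x) = \<rho> (Suc k)"
proof -
  have "Lie_g g (Omega R \<Theta> (Suc k)) x = Lie_g g (Omega R \<Theta> k) x @\<^sub>r Lie_g g (RT (Suc k)) x"
    unfolding Omega_Suc using k by (intro Lie_g_append[OF Omega_smooth_sum RT_smooth x]) auto
  moreover have "assumption_A p U g \<rho> R \<Theta> (Suc k)" using regular k by (simp add: regular_def)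
  ultimately show "full_row_rank (Lie_g g (Omega R \<Theta> (Suc k)) x)"
    "mat_rank (Lie_g g (Omega R \<Theta> (Suc k)) x) = \<rho> (Suc k)"
    using x by (auto simp: assumption_A_def Let_def)
qed

text \<open>At the point 0 of \<open>U\<close>, the matrix
  \<open>Lie_g g (Omega R \<Theta> k) 0\<close> has the sum as its number of rows and
  \<open>\<rho> k\<close> as its rank; full row rank equates the two.\<close>

lemma sum_rho_diff: "k \<le> K \<Longrightarrow> (\<Sum>l\<leftarrow>[1..<Suc k]. \<rho> l - \<rho> (l - 1)) = \<rho> k"
proof (induction k)
  case (Suc k)
  have "Lie_g g (Omega R \<Theta> (Suc k)) 0 \<in> carrier_mat (\<Sum>l\<leftarrow>[1..<Suc (Suc k)]. \<rho> l - \<rho> (l - 1)) m"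
    using smooth_mat_onD(1)[OF Lie_g_smooth[OF Omega_smooth_sum[OF Suc.prems]] U(2)] .
  then show ?case
    using full_rank_step[OF Suc.prems U(2)] by (simp add: full_row_rank_def)
qed (simp add: rho_0)

sublocale rank_sequence \<rho> K
proof
  fix k assume "k \<in> {1..K}"
  \<comment> \<open>Two consecutive sums give
    \<open>\<rho> k = \<rho> (k - 1) + (\<rho> k - \<rho> (k - 1))\<close>, which for truncated
    subtraction is the claim.\<close>
  then show "\<rho> (k - 1) \<le> \<rho> k"
    using sum_rho_diff[of k] sum_rho_diff[of "k - 1"] by (cases k) auto
qed (rule rho_0)

text \<open>The stack of \<open>R k\<close> and \<open>S k\<close> is square. If
  \<open>\<rho> k\<close> exceeded \<open>p\<close>, then \<open>S k\<close> would have no rows and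
  \<open>R k\<close> more rows than columns.\<close>

lemma rho_le_p: "k \<le> K \<Longrightarrow> \<rho> k \<le> p"
proof (induction k)
  case (Suc k)
  then have k: "Suc k \<in> {1..K}" by simp
  have "R (Suc k) @\<^sub>r S (Suc k) \<in> carrier_mat (\<rho> (Suc k) - \<rho> k + (p - \<rho> (Suc k))) (p - \<rho> k)"
    using carrier_append_rows[OF R_carrier[OF k] S_carrier[OF k]] by simp
  moreover have "square_mat (R (Suc k) @\<^sub>r S (Suc k))"
    using RS_invertible[OF k] by (simp add: invertible_mat_def)
  ultimately have "\<rho> (Suc k) - \<rho> k + (p - \<rho> (Suc k)) = p - \<rho> k" by auto
  then show ?case using Suc rho_step[OF k] by simp
qed (simp add: rho_0)

lemma Omega_smooth: "k \<le> K \<Longrightarrow> smooth_vec_on U (\<rho> k) (Omega R \<Theta> k)"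
  using Omega_smooth_sum[of k] sum_rho_diff[of k] by simp

lemma Omega_index:
  assumes "k \<le> K" "i < \<rho> k" "x \<in> U"
  shows "Omega R \<Theta> k x $ i = RT (q ! i) x $ pos i"
  using assms(1,2)
proof (induction k)
  case (Suc k)
  have d: "dim_vec (Omega R \<Theta> k x) = \<rho> k" using smooth_vec_onD(1)[OF Omega_smooth[of k] assms(3)] Suc.prems by simp
  have k: "Suc k \<in> {1..K}" using Suc.prems by simp
  have d': "dim_row (R (Suc k)) = \<rho> (Suc k) - \<rho> k" using carrier_matD(1)[OF R_carrier[OF k]] by simp
  show ?case
  proof (cases "i < \<rho> k")
    case True
    then show ?thesis using Suc d d' by (simp add: Omega_Suc)
  next
    case False
    then have "q ! i = Suc k" using Suc.prems k by (intro q_list_eqI) auto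
    then show ?thesis using False Suc.prems d d' by (simp add: Omega_Suc pos_def)
  qed
qed (simp add: rho_0)

text \<open>The right-hand side of the state equation. \<open>va\<close> and \<open>vb\<close> are
  the drift and the input matrix of the derivative of \<open>Omega R \<Theta> K\<close> along it, so
  v is \<open>va x + vb x *\<^sub>v u\<close>.\<close>

definition "flow x u = f x + g x *\<^sub>v u"
definition "va x = Lie_f f (Omega R \<Theta> K) x"
definition "vb x = Lie_g g (Omega R \<Theta> K) x"

lemma flow_carrier: "x \<in> U \<Longrightarrow> u \<in> carrier_vec m \<Longrightarrow> flow x u \<in> carrier_vec CARD('n)"
  using smooth_vec_onD(1)[OF f] smooth_mat_onD(1)[OF g] by (fastforce simp: flow_def)

lemma jac_flow:
  assumes F: "smooth_vec_on U r F" and x: "x \<in> U" and u: "u \<in> carrier_vec m"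
  shows "jac F x *\<^sub>v flow x u = Lie_f f F x + Lie_g g F x *\<^sub>v u"
proof -
  have J: "jac F x \<in> carrier_mat r CARD('n)" using jac_carrier smooth_vec_onD(1)[OF F x] .
  show ?thesis
    using J u smooth_vec_onD(1)[OF f x] smooth_mat_onD(1)[OF g x]
    by (simp add: flow_def Lie_f_def Lie_g_def mult_add_distrib_mat_vec[OF J] assoc_mult_mat_vec[OF J])
qed

lemma v_eq: "x \<in> U \<Longrightarrow> u \<in> carrier_vec m \<Longrightarrow> va x + vb x *\<^sub>v u = jac (Omega R \<Theta> K) x *\<^sub>v flow x u"
  unfolding va_def vb_def by (rule jac_flow[OF Omega_smooth, symmetric]) simp_all

lemma jac_Omega_index:
  assumes x: "x \<in> U" and w: "w \<in> carrier_vec CARD('n)" and i: "i < \<rho> K"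
  shows "(jac (Omega R \<Theta> K) x *\<^sub>v w) $ i = (jac (RT (q ! i)) x *\<^sub>v w) $ pos i"
proof -
  have q: "q ! i \<in> {1..K}" using q_list_nth(1)[OF order_refl i] .
  show ?thesis
    unfolding jac_mult_vec_index[OF Omega_smooth[OF order_refl] x i w]
      jac_mult_vec_index[OF RT_smooth[OF q] x pos_less[OF i] w]
    using frechet_derivative_cong_open[OF U(1) x, of "\<lambda>z. Omega R \<Theta> K z $ i" "\<lambda>z. RT (q ! i) z $ pos i"]
      Omega_index[OF order_refl i] by simp
qed

text \<open>The drift part is the defining formula of \<open>\<Theta> k\<close>, the input part the
  defining property of \<open>P k\<close>. Together, each \<open>P k l x\<close> multiplies the
  derivative of \<open>RT l\<close> along the flow, which is block \<open>l\<close> of v.\<close>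

lemma step_derivative:
  assumes k: "k \<in> {1..K}" and x: "x \<in> U" and u: "u \<in> carrier_vec m" and r: "r < p - \<rho> k"
  shows "(jac (ST k) x *\<^sub>v flow x u) $ r = \<Theta> k x $ r +
    (\<Sum>i = 0..<\<rho> k. P k (q ! i) x $$ (r, pos i) * (va x + vb x *\<^sub>v u) $ i)"
proof -
  let ?w = "flow x u"
  have RTk: "l \<in> {1..k} \<Longrightarrow> l \<in> {1..K}" for l using k by auto
  have Pc: "P k l x \<in> carrier_mat (p - \<rho> k) (\<rho> l - \<rho> (l - 1))" if "l \<in> {1..k}" for l
    using smooth_mat_onD(1)[OF P_smooth[OF k that] x] .
  have Lf: "Lie_f f (RT l) x \<in> carrier_vec (\<rho> l - \<rho> (l - 1))"
    and Lg: "Lie_g g (RT l) x \<in> carrier_mat (\<rho> l - \<rho> (l - 1)) m"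
    and Jc: "jac (RT l) x *\<^sub>v ?w \<in> carrier_vec (\<rho> l - \<rho> (l - 1))" if "l \<in> {1..k}" for l
    using smooth_vec_onD(1)[OF Lie_f_smooth[OF RT_smooth[OF RTk[OF that]]] x]
      smooth_mat_onD(1)[OF Lie_g_smooth[OF RT_smooth[OF RTk[OF that]]] x]
      jac_carrier[of "RT l" x, OF smooth_vec_onD(1)[OF RT_smooth[OF RTk[OF that]] x]] flow_carrier[OF x u] by auto
  have LfS: "Lie_f f (ST k) x \<in> carrier_vec (p - \<rho> k)" and LgS: "Lie_g g (ST k) x \<in> carrier_mat (p - \<rho> k) m"
    using smooth_vec_onD(1)[OF Lie_f_smooth[OF ST_smooth[OF k]] x]
      smooth_mat_onD(1)[OF Lie_g_smooth[OF ST_smooth[OF k]] x] by auto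
  have gc: "g x \<in> carrier_mat CARD('n) m" using smooth_mat_onD(1)[OF g x] .
  have Th: "\<Theta> k x $ r = Lie_f f (ST k) x $ r - (\<Sum>l=1..k. (P k l x *\<^sub>v Lie_f f (RT l) x) $ r)"
    using step[OF k] x r LfS by (simp add: zero_structure_step_def)
  have "(Lie_g g (ST k) x *\<^sub>v u) $ r = (\<Sum>j = 0..<m. (\<Sum>l=1..k. (P k l x * Lie_g g (RT l) x) $$ (r, j)) * u $ j)"
    unfolding mult_mat_vec_index[OF LgS u r] using step[OF k] x r gc
    by (intro sum.cong) (auto simp: zero_structure_step_def)
  also have "\<dots> = (\<Sum>l=1..k. ((P k l x * Lie_g g (RT l) x) *\<^sub>v u) $ r)"
    unfolding sum_distrib_right
    by (subst sum.swap, intro sum.cong refl, subst mult_mat_vec_index[OF mult_carrier_mat[OF Pc Lg] u r]) auto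
  also have "\<dots> = (\<Sum>l=1..k. (P k l x *\<^sub>v (Lie_g g (RT l) x *\<^sub>v u)) $ r)"
    by (intro sum.cong refl) (simp only: assoc_mult_mat_vec[OF Pc Lg u])
  finally have Sg: "(Lie_g g (ST k) x *\<^sub>v u) $ r = (\<Sum>l=1..k. (P k l x *\<^sub>v (Lie_g g (RT l) x *\<^sub>v u)) $ r)" .
  have "(jac (ST k) x *\<^sub>v ?w) $ r = Lie_f f (ST k) x $ r + (Lie_g g (ST k) x *\<^sub>v u) $ r"
    unfolding jac_flow[OF ST_smooth[OF k] x u] using LfS LgS u r by simp
  also have "\<dots> = \<Theta> k x $ r + (\<Sum>l=1..k. (P k l x *\<^sub>v Lie_f f (RT l) x) $ r + (P k l x *\<^sub>v (Lie_g g (RT l) x *\<^sub>v u)) $ r)"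
    unfolding Sg Th by (simp add: sum.distrib)
  also have "(\<Sum>l=1..k. (P k l x *\<^sub>v Lie_f f (RT l) x) $ r + (P k l x *\<^sub>v (Lie_g g (RT l) x *\<^sub>v u)) $ r)
      = (\<Sum>l=1..k. (P k l x *\<^sub>v (jac (RT l) x *\<^sub>v ?w)) $ r)"
  proof (intro sum.cong refl)
    fix l assume l: "l \<in> {1..k}"
    have "P k l x *\<^sub>v (jac (RT l) x *\<^sub>v ?w) = P k l x *\<^sub>v Lie_f f (RT l) x + P k l x *\<^sub>v (Lie_g g (RT l) x *\<^sub>v u)"
      unfolding jac_flow[OF RT_smooth[OF RTk[OF l]] x u]
      by (rule mult_add_distrib_mat_vec[OF Pc[OF l] Lf[OF l] mult_mat_vec_carrier[OF Lg[OF l] u]])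
    then show "(P k l x *\<^sub>v Lie_f f (RT l) x) $ r + (P k l x *\<^sub>v (Lie_g g (RT l) x *\<^sub>v u)) $ r
        = (P k l x *\<^sub>v (jac (RT l) x *\<^sub>v ?w)) $ r"
      using Pc[OF l] r by simp
  qed
  also have "\<dots> = (\<Sum>l=1..k. \<Sum>s = 0..<\<rho> l - \<rho> (l - 1). P k l x $$ (r, s) * (jac (RT l) x *\<^sub>v ?w) $ s)"
    by (intro sum.cong refl mult_mat_vec_index[OF Pc Jc r])
  also have "\<dots> = (\<Sum>i = 0..<\<rho> k. P k (q ! i) x $$ (r, pos i) * (jac (RT (q ! i)) x *\<^sub>v ?w) $ pos i)"
    using k by (intro sum_blocks) simp
  also have "\<dots> = (\<Sum>i = 0..<\<rho> k. P k (q ! i) x $$ (r, pos i) * (va x + vb x *\<^sub>v u) $ i)"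
  proof (intro sum.cong refl)
    fix i assume "i \<in> {0..<\<rho> k}"
    then have "i < \<rho> K" using rho_mono[of k K] k by auto
    then show "P k (q ! i) x $$ (r, pos i) * (jac (RT (q ! i)) x *\<^sub>v ?w) $ pos i
        = P k (q ! i) x $$ (r, pos i) * (va x + vb x *\<^sub>v u) $ i"
      using jac_Omega_index[OF x flow_carrier[OF x u]] v_eq[OF x u] by simp
  qed
  finally show ?thesis .
qed

section \<open>The chains of coordinates\<close>

lemma S_chain_carrier:
  "1 \<le> j \<Longrightarrow> j \<le> Suc i \<Longrightarrow> i \<le> K \<Longrightarrow> S_chain p \<rho> S i j \<in> carrier_mat (p - \<rho> i) (p - \<rho> (j - 1))"
proof (induction i)
  case 0
  then show ?case by (cases "j = 1") auto
next
  case (Suc i)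
  show ?case
  proof (cases "Suc i < j")
    case True
    then have "j - 1 = Suc i" using Suc.prems by simp
    then show ?thesis using True by simp
  next
    case False
    then have "S_chain p \<rho> S i j \<in> carrier_mat (p - \<rho> i) (p - \<rho> (j - 1))"
      using Suc by simp
    moreover have "S (Suc i) \<in> carrier_mat (p - \<rho> (Suc i)) (p - \<rho> i)"
      using S_carrier[of "Suc i"] Suc.prems by simp
    ultimately show ?thesis using False by simp
  qed
qed

lemma S_chain_Suc_self: "S_chain p \<rho> S i (Suc i) = 1\<^sub>m (p - \<rho> i)"
  by (cases i) simp_all

text \<open>The recursion of \<open>S_chain\<close> exposes the leftmost factor, while the
  derivative of \<open>\<zeta> c j\<close> needs the rightmost one, which acts on
  \<open>\<Theta> (j - 1)\<close>.\<close>

lemma S_chain_split: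
  "1 \<le> j \<Longrightarrow> j \<le> i \<Longrightarrow> i \<le> K \<Longrightarrow> S_chain p \<rho> S i j = S_chain p \<rho> S i (Suc j) * S j"
proof (induction i)
  case (Suc i)
  have c: "S (Suc i) \<in> carrier_mat (p - \<rho> (Suc i)) (p - \<rho> i)"
    using S_carrier[of "Suc i"] Suc.prems by simp
  show ?case
  proof (cases "j = Suc i")
    case True
    have e: "S_chain p \<rho> S (Suc i) (Suc i) = S (Suc i) * S_chain p \<rho> S i (Suc i)" by simp
    show ?thesis
      unfolding True e S_chain_Suc_self using c by simp
  next
    case False
    then have j: "j \<le> i" "i \<le> K" using Suc.prems by auto
    have "S_chain p \<rho> S (Suc i) j = S (Suc i) * (S_chain p \<rho> S i (Suc j) * S j)"
      using Suc.IH[OF Suc.prems(1) j] j by simp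
    also have "\<dots> = (S (Suc i) * S_chain p \<rho> S i (Suc j)) * S j"
      using assoc_mult_mat[OF c, of "S_chain p \<rho> S i (Suc j)" "p - \<rho> j" "S j" "p - \<rho> (j - 1)"]
        S_chain_carrier[of "Suc j" i] S_carrier[of j] j Suc.prems(1) by simp
    finally show ?thesis using j by simp
  qed
qed simp

text \<open>Indexed by the function it acts on: applied to \<open>\<Theta> j\<close> it gives
  \<open>\<zeta> c (Suc j)\<close>, and applied to \<open>ST j\<close> it gives
  \<open>\<zeta> c j\<close> when \<open>1 \<le> j < c\<close>.\<close>

definition "T c j = R c * S_chain p \<rho> S (c - 1) (Suc j)"

abbreviation "\<zeta> \<equiv> zeta p \<rho> R S \<Theta>"

lemma T_carrier: "c \<in> {1..K} \<Longrightarrow> j < c \<Longrightarrow> T c j \<in> carrier_mat (\<rho> c - \<rho> (c - 1)) (p - \<rho> j)"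
  unfolding T_def using S_chain_carrier[of "Suc j" "c - 1"]
  by (intro mult_carrier_mat[OF R_carrier]) auto

lemma zeta_eq: "\<zeta> c (Suc j) = (\<lambda>x. T c j *\<^sub>v \<Theta> j x)"
  by (rule ext) (simp add: zeta_def T_def)

lemma zeta_smooth: "c \<in> {1..K} \<Longrightarrow> j < c \<Longrightarrow> smooth_vec_on U (\<rho> c - \<rho> (c - 1)) (\<zeta> c (Suc j))"
  unfolding zeta_eq by (rule smooth_const_mult[OF T_carrier Theta_smooth]) auto

lemma zeta_step:
  assumes c: "c \<in> {1..K}" and j: "j \<in> {1..<c}" and x: "x \<in> U"
  shows "\<zeta> c j x = T c j *\<^sub>v ST j x"
proof -
  have Th: "\<Theta> (j - 1) x \<in> carrier_vec (p - \<rho> (j - 1))"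
    using smooth_vec_onD(1)[OF Theta_smooth x] c j by auto
  have Sj: "S j \<in> carrier_mat (p - \<rho> j) (p - \<rho> (j - 1))" using S_carrier c j by auto
  have "R c * S_chain p \<rho> S (c - 1) j = R c * (S_chain p \<rho> S (c - 1) (Suc j) * S j)"
    using S_chain_split[of j "c - 1"] c j by auto
  also have "\<dots> = T c j * S j"
    unfolding T_def using S_chain_carrier[of "Suc j" "c - 1"] c j
    by (intro assoc_mult_mat[OF R_carrier[OF c] _ Sj, symmetric]) auto
  finally show ?thesis
    unfolding zeta_def using assoc_mult_mat_vec[OF T_carrier Sj Th] c j by auto
qed

lemma zeta_last:
  assumes c: "c \<in> {1..K}"
  shows "\<zeta> c c = RT c"
proof
  have "S_chain p \<rho> S (c - 1) c = 1\<^sub>m (p - \<rho> (c - 1))" using S_chain_Suc_self[of "c - 1"] c by simp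
  then show "\<zeta> c c x = RT c x" for x using R_carrier[OF c] by (simp add: zeta_def)
qed

text \<open>For \<open>l < \<rho> j\<close> this is the entry in row \<open>pos i\<close> and column
  \<open>pos l\<close> of the product of \<open>T (q ! i) j\<close> and
  \<open>P j (q ! l) x\<close>. The condition says that the block of row \<open>l\<close> has number
  at most \<open>j\<close>; later blocks do not enter step \<open>j\<close>.\<close>

definition delta :: "nat \<Rightarrow> nat \<Rightarrow> nat \<Rightarrow> real^'n \<Rightarrow> real" where
  "delta i j l x = (if l < \<rho> j then
     \<Sum>r = 0..<p - \<rho> j. T (q ! i) j $$ (pos i, r) * P j (q ! l) x $$ (r, pos l) else 0)"

lemma delta_smooth:
  assumes i: "i < \<rho> K" and j: "j \<in> {1..<q ! i}"
  shows "smooth_on U (delta i j l)"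
proof (cases "l < \<rho> j")
  case True
  have jK: "j \<in> {1..K}" using j q_list_nth(1)[OF order_refl i] by auto
  have "q ! l \<in> {1..j}" using q_list_nth(1)[OF _ True] jK by auto
  moreover have "pos l < \<rho> (q ! l) - \<rho> (q ! l - 1)"
    using True rho_mono[of j K] jK by (intro pos_less) auto
  ultimately have "smooth_on U (\<lambda>x. \<Sum>r = 0..<p - \<rho> j. T (q ! i) j $$ (pos i, r) * P j (q ! l) x $$ (r, pos l))"
    using jK by (intro smooth_on_sum smooth_on_mult smooth_on_const U smooth_mat_onD(2)[OF P_smooth]) auto
  then show ?thesis using True by (simp add: delta_def[abs_def])
next
  case False
  then show ?thesis by (simp add: delta_def[abs_def] smooth_on_const)
qed

text \<open>Row \<open>l\<close> starts no earlier than \<open>\<rho> (q ! l - 1)\<close>, which is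
  at least \<open>\<rho> j\<close>; so the default value 0 applies.\<close>

lemma delta_eq_0:
  assumes l: "l < \<rho> K" and j: "j < q ! l"
  shows "delta i j l x = 0"
proof -
  have "\<rho> j \<le> \<rho> (q ! l - 1)" using j q_list_nth(1)[OF order_refl l] by (intro rho_mono) auto
  then show ?thesis using q_list_nth(2)[OF order_refl l] by (simp add: delta_def)
qed

text \<open>The constant matrix \<open>T (q ! i) j\<close> passes through the derivative of
  \<open>ST j\<close>; it turns \<open>\<Theta> j\<close> into the next element of the chain and the
  coefficients \<open>P j\<close> into \<open>delta\<close>.\<close>

lemma zeta_derivative:
  assumes i: "i < \<rho> K" and j: "j \<in> {1..<q ! i}" and x: "x \<in> U" and u: "u \<in> carrier_vec m"
  shows "(jac (\<zeta> (q ! i) j) x *\<^sub>v flow x u) $ pos i =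
    \<zeta> (q ! i) (Suc j) x $ pos i + (\<Sum>l<i. delta i j l x * (va x + vb x *\<^sub>v u) $ l)"
proof -
  let ?c = "q ! i" and ?v = "va x + vb x *\<^sub>v u" and ?w = "flow x u"
  have c: "?c \<in> {1..K}" using q_list_nth(1)[OF order_refl i] .
  have jK: "j \<in> {1..K}" using j c by auto
  have Tc: "T ?c j \<in> carrier_mat (\<rho> ?c - \<rho> (?c - 1)) (p - \<rho> j)" using T_carrier[OF c] j by simp
  have STc: "jac (ST j) x \<in> carrier_mat (p - \<rho> j) CARD('n)"
    using jac_carrier[of "ST j" x] smooth_vec_onD(1)[OF ST_smooth[OF jK] x] by simp
  note w = flow_carrier[OF x u] and s = pos_less[OF i]
  have Jw: "jac (ST j) x *\<^sub>v ?w \<in> carrier_vec (p - \<rho> j)" using mult_mat_vec_carrier[OF STc w] .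
  have Th: "\<Theta> j x \<in> carrier_vec (p - \<rho> j)" using smooth_vec_onD(1)[OF Theta_smooth x] jK by simp
  have "\<rho> j \<le> \<rho> (?c - 1)" using j c by (intro rho_mono) auto
  then have le: "\<rho> j \<le> i" using q_list_nth(2)[OF order_refl i] by simp
  have "jac (\<zeta> ?c j) x = jac (\<lambda>z. T ?c j *\<^sub>v ST j z) x"
    using zeta_step[OF c j] by (intro jac_cong[OF U(1) x])
  also have "\<dots> = T ?c j * jac (ST j) x" by (rule jac_mult_const[OF U(1) x ST_smooth[OF jK] Tc])
  finally have "jac (\<zeta> ?c j) x *\<^sub>v ?w = T ?c j *\<^sub>v (jac (ST j) x *\<^sub>v ?w)"
    using assoc_mult_mat_vec[OF Tc STc w] by simp
  then have "(jac (\<zeta> ?c j) x *\<^sub>v ?w) $ pos i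
      = (\<Sum>r = 0..<p - \<rho> j. T ?c j $$ (pos i, r) * (jac (ST j) x *\<^sub>v ?w) $ r)"
    using mult_mat_vec_index[OF Tc Jw s] by simp
  also have "\<dots> = (\<Sum>r = 0..<p - \<rho> j. T ?c j $$ (pos i, r) * \<Theta> j x $ r +
      (\<Sum>l = 0..<\<rho> j. T ?c j $$ (pos i, r) * P j (q ! l) x $$ (r, pos l) * ?v $ l))"
    by (intro sum.cong refl, subst step_derivative[OF jK x u])
      (simp_all add: distrib_left sum_distrib_left mult.assoc)
  also have "\<dots> = \<zeta> ?c (Suc j) x $ pos i
      + (\<Sum>r = 0..<p - \<rho> j. \<Sum>l = 0..<\<rho> j. T ?c j $$ (pos i, r) * P j (q ! l) x $$ (r, pos l) * ?v $ l)"
    unfolding zeta_eq mult_mat_vec_index[OF Tc Th s] by (rule sum.distrib)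
  also have "(\<Sum>r = 0..<p - \<rho> j. \<Sum>l = 0..<\<rho> j. T ?c j $$ (pos i, r) * P j (q ! l) x $$ (r, pos l) * ?v $ l)
      = (\<Sum>l = 0..<\<rho> j. delta i j l x * ?v $ l)"
    by (subst sum.swap) (simp add: delta_def sum_distrib_right)
  \<comment> \<open>Since \<open>j < q ! i\<close>, the rows below \<open>\<rho> j\<close> precede
    row \<open>i\<close>, and \<open>delta\<close> vanishes at the added indices. This gives the
    triangular form.\<close>
  also have "\<dots> = (\<Sum>l<i. delta i j l x * ?v $ l)"
    using le by (intro sum.mono_neutral_left) (auto simp: delta_def)
  finally show ?thesis .
qed

lemma zeta_last_derivative:
  assumes i: "i < \<rho> K" and x: "x \<in> U" and u: "u \<in> carrier_vec m"
  shows "(jac (\<zeta> (q ! i) (q ! i)) x *\<^sub>v flow x u) $ pos i = (va x + vb x *\<^sub>v u) $ i"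
  using jac_Omega_index[OF x flow_carrier[OF x u] i] v_eq[OF x u] zeta_last q_list_nth(1)[OF order_refl i]
  by simp

text \<open>A chain follows one fixed row, \<open>pos i\<close>, through the blocks
  \<open>\<zeta> (q ! i) 1\<close> up to \<open>\<zeta> (q ! i) (q ! i)\<close>. Entries are
  numbered from 0.\<close>

definition xi :: "nat \<Rightarrow> real^'n \<Rightarrow> real Matrix.vec" where
  "xi i x = Matrix.vec (q ! i) (\<lambda>j. \<zeta> (q ! i) (Suc j) x $ pos i)"

lemma xi_smooth:
  assumes i: "i < \<rho> K"
  shows "smooth_vec_on U (q ! i) (xi i)"
  unfolding smooth_vec_on_def
  using smooth_vec_onD(2)[OF zeta_smooth[OF q_list_nth(1)[OF order_refl i]] pos_less[OF i]]
  by (auto simp: xi_def)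

lemma jac_xi_index:
  assumes i: "i < \<rho> K" and x: "x \<in> U" and w: "w \<in> carrier_vec CARD('n)" and j: "j < q ! i"
  shows "(jac (xi i) x *\<^sub>v w) $ j = (jac (\<zeta> (q ! i) (Suc j)) x *\<^sub>v w) $ pos i"
  unfolding jac_mult_vec_index[OF xi_smooth[OF i] x j w]
    jac_mult_vec_index[OF zeta_smooth[OF q_list_nth(1)[OF order_refl i] j] x pos_less[OF i] w]
  using j by (simp add: xi_def)

text \<open>The lower rows are those of
  \<open>R\<^sub>c S\<^sub>c\<^sub>-\<^sub>1 \<cdots> S\<^sub>1\<close>, which produce the first
  element of each chain; the upper rows \<open>S\<^sub>K \<cdots> S\<^sub>1\<close> collect the
  output combinations left after the last step.\<close>

definition Gamma_o :: "real mat" where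
  "Gamma_o = S_chain p \<rho> S K 1 @\<^sub>r Matrix.mat (\<rho> K) p (\<lambda>(i, k). T (q ! i) 0 $$ (pos i, k))"

lemma S_chain_K_carrier: "S_chain p \<rho> S K 1 \<in> carrier_mat (p - \<rho> K) p"
  using S_chain_carrier[of 1 K] by (simp add: rho_0)

lemma Gamma_o_carrier: "Gamma_o \<in> carrier_mat p p"
  unfolding Gamma_o_def
  using carrier_append_rows[OF S_chain_K_carrier, of "Matrix.mat (\<rho> K) p _" "\<rho> K"] rho_le_p[of K] by simp

lemma T_0_carrier: "c \<in> {1..K} \<Longrightarrow> T c 0 \<in> carrier_mat (\<rho> c - \<rho> (c - 1)) p"
  using T_carrier[of c 0] by (simp add: rho_0)

lemma Gamma_o_mult:
  assumes w: "w \<in> carrier_vec p"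
  shows "Gamma_o *\<^sub>v w = (S_chain p \<rho> S K 1 *\<^sub>v w) @\<^sub>v
    Matrix.vec (\<rho> K) (\<lambda>i. (T (q ! i) 0 *\<^sub>v w) $ pos i)"
proof -
  let ?G = "Matrix.mat (\<rho> K) p (\<lambda>(i, k). T (q ! i) 0 $$ (pos i, k)) :: real mat"
  have "?G *\<^sub>v w = Matrix.vec (\<rho> K) (\<lambda>i. (T (q ! i) 0 *\<^sub>v w) $ pos i)"
  proof (rule Matrix.eq_vecI)
    fix i assume "i < dim_vec (Matrix.vec (\<rho> K) (\<lambda>i. (T (q ! i) 0 *\<^sub>v w) $ pos i))"
    then have i: "i < \<rho> K" by simp
    have G: "?G \<in> carrier_mat (\<rho> K) p" by simp
    show "(?G *\<^sub>v w) $ i = Matrix.vec (\<rho> K) (\<lambda>i. (T (q ! i) 0 *\<^sub>v w) $ pos i) $ i"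
      using mult_mat_vec_index[OF G w i]
        mult_mat_vec_index[OF T_0_carrier[OF q_list_nth(1)[OF order_refl i]] w pos_less[OF i]] i
      by simp
  qed simp
  then show ?thesis
    unfolding Gamma_o_def using mat_mult_append[OF S_chain_K_carrier _ w, of ?G "\<rho> K"] by simp
qed

text \<open>If \<open>S\<^sub>k \<cdots> S\<^sub>1 w\<close> and \<open>R\<^sub>k S\<^sub>k\<^sub>-\<^sub>1 \<cdots> S\<^sub>1 w\<close> vanish, so does \<open>S\<^sub>k\<^sub>-\<^sub>1 \<cdots> S\<^sub>1 w\<close>, because \<open>col {R\<^sub>k, S\<^sub>k}\<close> is
  nonsingular; descending from \<open>k = K\<close> gives \<open>w = 0\<close>.\<close>

lemma Gamma_o_invertible: "invertible_mat Gamma_o"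
  unfolding invertible_mat_iff_kernel[OF Gamma_o_carrier]
proof (intro ballI impI)
  fix w assume w: "w \<in> carrier_vec p" and zero: "Gamma_o *\<^sub>v w = 0\<^sub>v p"
  have "p = (p - \<rho> K) + \<rho> K" using rho_le_p[of K] by simp
  then have "(S_chain p \<rho> S K 1 *\<^sub>v w) @\<^sub>v Matrix.vec (\<rho> K) (\<lambda>i. (T (q ! i) 0 *\<^sub>v w) $ pos i)
      = 0\<^sub>v ((p - \<rho> K) + \<rho> K)"
    using zero unfolding Gamma_o_mult[OF w] by simp
  then have SK: "S_chain p \<rho> S K 1 *\<^sub>v w = 0\<^sub>v (p - \<rho> K)"
    and TK: "Matrix.vec (\<rho> K) (\<lambda>i. (T (q ! i) 0 *\<^sub>v w) $ pos i) = 0\<^sub>v (\<rho> K)"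
    using append_vec_eq_zero_iff[OF mult_mat_vec_carrier[OF S_chain_K_carrier w]] by auto
  have T0: "T c 0 *\<^sub>v w = 0\<^sub>v (\<rho> c - \<rho> (c - 1))" if c: "c \<in> {1..K}" for c
  proof (rule Matrix.eq_vecI)
    fix s assume "s < dim_vec (0\<^sub>v (\<rho> c - \<rho> (c - 1)) :: real Matrix.vec)"
    then have s: "s < \<rho> c - \<rho> (c - 1)" by simp
    \<comment> \<open>The single rows of the lower part are reassembled into the block of number
      \<open>c\<close>.\<close>
    let ?i = "\<rho> (c - 1) + s"
    have "?i < \<rho> K" using q_list_block(1)[OF c s] rho_mono[of c K] c by auto
    then have "(T (q ! ?i) 0 *\<^sub>v w) $ pos ?i = 0"
      using arg_cong[OF TK, of "\<lambda>v. v $ ?i"] by simp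
    then show "(T c 0 *\<^sub>v w) $ s = 0\<^sub>v (\<rho> c - \<rho> (c - 1)) $ s"
      using q_list_block[OF c s] s by simp
  qed (use T_0_carrier[OF c] in simp)
  have "S_chain p \<rho> S (K - d) 1 *\<^sub>v w = 0\<^sub>v (p - \<rho> (K - d))" if "d \<le> K" for d
    using that
  proof (induction d)
    case 0
    show ?case using SK by simp
  next
    case (Suc d)
    let ?k = "K - d" and ?k' = "K - Suc d"
    have k: "?k \<in> {1..K}" "?k = Suc ?k'" "?k - 1 = ?k'" using Suc.prems by auto
    let ?y = "S_chain p \<rho> S ?k' 1 *\<^sub>v w"
    have Sc: "S_chain p \<rho> S ?k' 1 \<in> carrier_mat (p - \<rho> ?k') p"
      using S_chain_carrier[of 1 ?k'] by (simp add: rho_0)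
    have y: "?y \<in> carrier_vec (p - \<rho> ?k')" using mult_mat_vec_carrier[OF Sc w] .
    have Rk: "R ?k \<in> carrier_mat (\<rho> ?k - \<rho> ?k') (p - \<rho> ?k')" using R_carrier[OF k(1)] k(3) by simp
    have Sk: "S ?k \<in> carrier_mat (p - \<rho> ?k) (p - \<rho> ?k')" using S_carrier[OF k(1)] k(3) by simp
    have "\<rho> ?k - \<rho> ?k' + (p - \<rho> ?k) = p - \<rho> ?k'"
      using rho_step[OF k(1)] rho_le_p[of ?k] k(3) by simp
    then have RS: "R ?k @\<^sub>r S ?k \<in> carrier_mat (p - \<rho> ?k') (p - \<rho> ?k')"
      and sz: "0\<^sub>v (p - \<rho> ?k') = (0\<^sub>v (\<rho> ?k - \<rho> ?k' + (p - \<rho> ?k)) :: real Matrix.vec)"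
      using carrier_append_rows[OF Rk Sk] by simp_all
    have "T ?k 0 *\<^sub>v w = R ?k *\<^sub>v ?y"
      unfolding T_def using assoc_mult_mat_vec[OF Rk Sc w] k(3) by simp
    then have "R ?k *\<^sub>v ?y = 0\<^sub>v (\<rho> ?k - \<rho> ?k')" using T0[OF k(1)] k(3) by simp
    moreover have "S_chain p \<rho> S ?k 1 = S ?k * S_chain p \<rho> S ?k' 1" using k(2) by simp
    then have "S ?k *\<^sub>v ?y = 0\<^sub>v (p - \<rho> ?k)"
      using Suc assoc_mult_mat_vec[OF Sk Sc w] by simp
    ultimately have "(R ?k @\<^sub>r S ?k) *\<^sub>v ?y = 0\<^sub>v (p - \<rho> ?k')"
      unfolding sz mat_mult_append[OF Rk Sk y]
      by (subst append_vec_eq_zero_iff) auto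
    then show ?case
      using RS_invertible[OF k(1)] y unfolding invertible_mat_iff_kernel[OF RS] by blast
  qed
  from this[of K] show "w = 0\<^sub>v p" using w by (simp add: rho_0)
qed

definition "h_e x = S_chain p \<rho> S K 1 *\<^sub>v h x"

lemma h_e_smooth: "smooth_vec_on U (p - \<rho> K) h_e"
  unfolding h_e_def[abs_def] by (rule smooth_const_mult[OF S_chain_K_carrier h])

text \<open>The first chain elements are \<open>T (q ! i) 0\<close> applied to
  \<open>\<Theta> 0\<close>, and \<open>\<Theta> 0\<close> is \<open>h\<close>.\<close>

lemma output_transformation:
  assumes x: "x \<in> U"
  shows "Gamma_o *\<^sub>v h x = h_e x @\<^sub>v Matrix.vec (\<rho> K) (\<lambda>i. xi i x $ 0)"
proof -
  have "xi i x $ 0 = (T (q ! i) 0 *\<^sub>v h x) $ pos i" if "i < \<rho> K" for i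
    using q_list_nth(1)[OF order_refl that] by (simp add: xi_def zeta_eq Theta_0)
  then show ?thesis
    unfolding Gamma_o_mult[OF smooth_vec_onD(1)[OF h x]] h_e_def by (auto intro!: arg_cong2[of _ _ _ _ "(@\<^sub>v)"])
qed

lemma xi_dynamics:
  assumes i: "i < \<rho> K" and x: "x \<in> U" and u: "u \<in> carrier_vec m"
  shows "j \<in> {1..<q ! i} \<Longrightarrow> (jac (xi i) x *\<^sub>v flow x u) $ (j - 1) =
      xi i x $ j + (\<Sum>l<i. delta i j l x * (va x + vb x *\<^sub>v u) $ l)"
    and "(jac (xi i) x *\<^sub>v flow x u) $ (q ! i - 1) = (va x + vb x *\<^sub>v u) $ i"
proof -
  note w = flow_carrier[OF x u]
  show "(jac (xi i) x *\<^sub>v flow x u) $ (j - 1) =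
      xi i x $ j + (\<Sum>l<i. delta i j l x * (va x + vb x *\<^sub>v u) $ l)" if j: "j \<in> {1..<q ! i}"
  proof -
    have "j - 1 < q ! i" "Suc (j - 1) = j" using j by auto
    then show ?thesis
      using jac_xi_index[OF i x w, of "j - 1"] zeta_derivative[OF i j x u] j by (simp add: xi_def)
  qed
  show "(jac (xi i) x *\<^sub>v flow x u) $ (q ! i - 1) = (va x + vb x *\<^sub>v u) $ i"
    using jac_xi_index[OF i x w, of "q ! i - 1"] zeta_last_derivative[OF i x u]
      q_list_nth(1)[OF order_refl i] by simp
qed

lemma va_smooth: "smooth_vec_on U (\<rho> K) va"
  unfolding va_def[abs_def] by (rule Lie_f_smooth[OF Omega_smooth]) simp

lemma vb_smooth: "smooth_mat_on U (\<rho> K) m vb"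
  unfolding vb_def[abs_def] by (rule Lie_g_smooth[OF Omega_smooth]) simp

lemma vb_full_row_rank: "x \<in> U \<Longrightarrow> full_row_rank (vb x)"
  unfolding vb_def using full_rank_step(1)[of "K - 1"] K by simp

end

section \<open>Local coordinates\<close>

lemma smooth_on_vec_to_state:
  assumes U: "open U" and G: "smooth_vec_on U CARD('n) G"
  shows "smooth_on U (\<lambda>x. vec_to_state (G x) :: real^'n)"
  unfolding smooth_on_def
proof (intro allI Ck_on_vec_lambda[OF U])
  fix k and i :: 'n
  show "Ck_on k U (\<lambda>x. vec_nth (vec_to_state (G x) :: real^'n) i)"
    using smooth_vec_onD(2)[OF G to_nat_on_UNIV_less[of i]] by (simp add: smooth_on_def vec_to_state_def)
qed

text \<open>A vector killed by the derivative is killed, in the numbered coordinates, by the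
  Jacobian matrix. This carries the matrix argument over to the Euclidean space where the inverse
  function theorem lives.\<close>

lemma inj_derivative_vec_to_state:
  fixes U :: "(real^'n) set"
  assumes U: "open U" "x \<in> U" and G: "smooth_vec_on U CARD('n) G"
    and ker: "\<And>w. w \<in> carrier_vec CARD('n) \<Longrightarrow> jac G x *\<^sub>v w = 0\<^sub>v CARD('n) \<Longrightarrow> w = 0\<^sub>v CARD('n)"
  shows "inj (frechet_derivative (\<lambda>x. vec_to_state (G x) :: real^'n) (at x))"
proof -
  let ?F = "\<lambda>x. vec_to_state (G x) :: real^'n"
  let ?D = "frechet_derivative ?F (at x)"
  have D: "(?F has_derivative ?D) (at x)"
    by (rule smooth_on_has_derivative[OF smooth_on_vec_to_state[OF U(1) G] U(2)])
  have "w = 0" if w: "?D w = 0" for w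
  proof -
    have "(jac G x *\<^sub>v state_to_vec w) $ k = 0" if k: "k < CARD('n)" for k
    proof -
      let ?i = "from_nat_into UNIV k :: 'n"
      have "to_nat_on UNIV ?i = k" using to_nat_on_UNIV_eq_iff[OF k] by simp
      then have "((\<lambda>z. G z $ k) has_derivative (\<lambda>w. vec_nth (?D w) ?i)) (at x)"
        using bounded_linear.has_derivative[OF bounded_linear_vec_nth[of ?i] D] by (simp add: vec_to_state_def)
      then have "frechet_derivative (\<lambda>z. G z $ k) (at x) w = vec_nth (?D w) ?i"
        by (simp only: frechet_derivative_at[symmetric])
      then show ?thesis
        using jac_mult_vec_index[OF G U(2) k state_to_vec_carrier] w by simp
    qed
    moreover have "jac G x \<in> carrier_mat CARD('n) CARD('n)"
      by (rule jac_carrier[of G x, OF smooth_vec_onD(1)[OF G U(2)]])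
    ultimately have "jac G x *\<^sub>v state_to_vec w = 0\<^sub>v CARD('n)"
      by (intro Matrix.eq_vecI) auto
    then have "state_to_vec w = 0\<^sub>v CARD('n)" by (rule ker[OF state_to_vec_carrier])
    then have "w = vec_to_state (0\<^sub>v CARD('n))" by (metis vec_to_state_to_vec)
    then show ?thesis
      by (simp add: vec_to_state_def to_nat_on_UNIV_less Finite_Cartesian_Product.vec_eq_iff)
  qed
  then show ?thesis
    using linear_injective_0[OF has_derivative_linear[OF D]] by blast
qed

lemma smooth_vec_on_state_to_vec:
  "open U \<Longrightarrow> smooth_vec_on U CARD('n) (state_to_vec :: real^'n \<Rightarrow> _)"
  unfolding smooth_vec_on_def by (auto intro: smooth_on_bounded_linear bounded_linear_state_to_vec)

lemma jac_linear_coordinates: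
  fixes U :: "(real^'n) set"
  assumes U: "open U" "x \<in> U" and C: "C \<in> carrier_mat r CARD('n)" and w: "w \<in> carrier_vec CARD('n)"
  shows "jac (\<lambda>z. C *\<^sub>v state_to_vec z) x *\<^sub>v w = C *\<^sub>v w"
proof -
  note sm = smooth_vec_on_state_to_vec[OF U(1)]
  have J: "jac state_to_vec x \<in> carrier_mat CARD('n) CARD('n)" by (intro jac_carrier) simp
  have "jac state_to_vec x *\<^sub>v w = w"
  proof (rule Matrix.eq_vecI)
    fix i assume "i < dim_vec w"
    then have i: "i < CARD('n)" using w by simp
    have "((\<lambda>z :: real^'n. state_to_vec z $ i) has_derivative (\<lambda>z. state_to_vec z $ i)) (at x)"
      by (rule bounded_linear_imp_has_derivative[OF bounded_linear_state_to_vec[OF i]])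
    then have "frechet_derivative (\<lambda>z :: real^'n. state_to_vec z $ i) (at x) = (\<lambda>z. state_to_vec z $ i)"
      by (simp only: frechet_derivative_at[symmetric])
    then show "(jac state_to_vec x *\<^sub>v w) $ i = w $ i"
      using jac_mult_vec_index[OF sm U(2) i w] state_to_vec_to_state[OF w] by simp
  qed (use J w in auto)
  then show ?thesis
    unfolding jac_mult_const[OF U sm C] using assoc_mult_mat_vec[OF C J w] by simp
qed

text \<open>Cutting the columns at \<open>a\<close> will separate the coefficient of the free inputs
  from that of v.\<close>

lemma mult_mat_vec_split:
  fixes N :: "real mat"
  assumes N: "N \<in> carrier_mat r (a + b)" and y: "y \<in> carrier_vec a" and z: "z \<in> carrier_vec b"
  shows "N *\<^sub>v (y @\<^sub>v z) = Matrix.mat r a (\<lambda>(i, j). N $$ (i, j)) *\<^sub>v y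
    + Matrix.mat r b (\<lambda>(i, j). N $$ (i, a + j)) *\<^sub>v z" (is "_ = ?N1 *\<^sub>v y + ?N2 *\<^sub>v z")
proof (rule Matrix.eq_vecI)
  fix i assume "i < dim_vec (?N1 *\<^sub>v y + ?N2 *\<^sub>v z)"
  then have i: "i < r" by simp
  have yz: "y @\<^sub>v z \<in> carrier_vec (a + b)" using y z by simp
  have N1: "?N1 \<in> carrier_mat r a" and N2: "?N2 \<in> carrier_mat r b" by simp_all
  have "(N *\<^sub>v (y @\<^sub>v z)) $ i = (\<Sum>k = 0..<a + b. N $$ (i, k) * (y @\<^sub>v z) $ k)"
    by (rule mult_mat_vec_index[OF N yz i])
  also have "\<dots> = (\<Sum>k = 0..<a. N $$ (i, k) * (y @\<^sub>v z) $ k) + (\<Sum>k = a..<a + b. N $$ (i, k) * (y @\<^sub>v z) $ k)"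
    by (simp add: sum.atLeastLessThan_concat)
  also have "(\<Sum>k = a..<a + b. N $$ (i, k) * (y @\<^sub>v z) $ k) = (\<Sum>k = 0..<b. N $$ (i, a + k) * (y @\<^sub>v z) $ (a + k))"
    by (subst sum.atLeastLessThan_shift_0) (simp add: add.commute)
  finally show "(N *\<^sub>v (y @\<^sub>v z)) $ i = (?N1 *\<^sub>v y + ?N2 *\<^sub>v z) $ i"
    using mult_mat_vec_index[OF N1 y i] mult_mat_vec_index[OF N2 z i] i y z by simp
qed (use N in simp)

text \<open>Here \<open>d\<close> will be the product of \<phi> and the drift \<open>va x\<close>:
  removed from the drift of \<eta>, it completes \<open>vb x *\<^sub>v u\<close> to v.\<close>

lemma vec_add_regroup:
  fixes a b c d :: "real Matrix.vec"
  assumes "a \<in> carrier_vec r" "b \<in> carrier_vec r" "c \<in> carrier_vec r" "d \<in> carrier_vec r"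
  shows "a + (b + c) = a - d + b + (d + c)"
  using assms by (intro Matrix.eq_vecI) auto

lemma vec_first_append: "y \<in> carrier_vec a \<Longrightarrow> vec_first (y @\<^sub>v z) a = y"
  by (intro Matrix.eq_vecI) (auto simp: vec_first_def)

section \<open>Coordinates and inputs near a point\<close>

context regular_system
begin

abbreviation "Xi \<equiv> \<lambda>x. col_vec (map (\<lambda>i. xi i x) [0..<\<rho> K])"

lemma sum_list_q_nth: "(\<Sum>i\<leftarrow>[0..<\<rho> K]. q ! i) = n_upto \<rho> K"
  using sum_list_q_list[of \<rho> K] map_nth[of q] length_q by simp

lemma Xi_smooth: "smooth_vec_on U (n_upto \<rho> K) Xi"
  using smooth_vec_on_col_vec[OF U(1), of "[0..<\<rho> K]" "\<lambda>i. q ! i" xi] xi_smooth sum_list_q_nth by simp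

lemma sum_list_block_sizes:
  "(\<Sum>c\<leftarrow>[1..<Suc K]. \<Sum>j\<leftarrow>[1..<Suc c]. \<rho> c - \<rho> (c - 1)) = n_upto \<rho> K"
proof -
  have "(\<Sum>j\<leftarrow>[1..<Suc c]. \<rho> c - \<rho> (c - 1)) = c * (\<rho> c - \<rho> (c - 1))" for c
    by (simp add: sum_list_triv del: upt_Suc)
  then show ?thesis
    by (simp only: interv_sum_list_conv_sum_set_nat set_upt n_upto_def atLeastLessThanSuc_atLeastAtMost)
qed

lemma zeta_block_smooth:
  "c \<in> {1..K} \<Longrightarrow> j \<in> {1..c} \<Longrightarrow> smooth_vec_on U (\<rho> c - \<rho> (c - 1)) (\<zeta> c j)"
  using zeta_smooth[of c "j - 1"] by auto

lemma Phi_d_smooth: "smooth_vec_on U (n_upto \<rho> K) (Phi_d p \<rho> R S \<Theta> K)"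
  unfolding Phi_d_def[abs_def] sum_list_block_sizes[symmetric]
  by (intro smooth_vec_on_col_vec U(1) zeta_block_smooth) auto

text \<open>Both functions have the same components in different orders: row \<open>s\<close> of
  \<open>\<zeta> c j\<close> is entry \<open>j - 1\<close> of the chain
  \<open>\<rho> (c - 1) + s\<close>. Comparing kernels avoids an explicit permutation.\<close>

lemma Phi_d_kernel:
  assumes x: "x \<in> U" and w: "w \<in> carrier_vec CARD('n)"
    and Xi: "jac Xi x *\<^sub>v w = 0\<^sub>v (n_upto \<rho> K)"
  shows "jac (Phi_d p \<rho> R S \<Theta> K) x *\<^sub>v w = 0\<^sub>v (n_upto \<rho> K)"
proof -
  have xi0: "jac (xi i) x *\<^sub>v w = 0\<^sub>v (q ! i)" if "i < \<rho> K" for i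
    using jac_col_vec_kernel[where ks = "[0..<\<rho> K]" and d = "\<lambda>i. q ! i" and F = xi, OF U(1) x xi_smooth w] Xi that
    unfolding sum_list_q_nth by simp
  have zeta0: "jac (\<zeta> c j) x *\<^sub>v w = 0\<^sub>v (\<rho> c - \<rho> (c - 1))" if c: "c \<in> {1..K}" and j: "j \<in> {1..c}" for c j
  proof (rule Matrix.eq_vecI)
    fix s assume "s < dim_vec (0\<^sub>v (\<rho> c - \<rho> (c - 1)) :: real Matrix.vec)"
    then have s: "s < \<rho> c - \<rho> (c - 1)" by simp
    let ?i = "\<rho> (c - 1) + s"
    have i: "?i < \<rho> K" using q_list_block(1)[OF c s] rho_mono[of c K] c by auto
    have j': "j - 1 < q ! ?i" "Suc (j - 1) = j" using j q_list_block(2)[OF c s] by auto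
    show "(jac (\<zeta> c j) x *\<^sub>v w) $ s = 0\<^sub>v (\<rho> c - \<rho> (c - 1)) $ s"
      using jac_xi_index[OF i x w j'(1)] xi0[OF i] j' s q_list_block(2,3)[OF c s] by simp
  next
    have "jac (\<zeta> c j) x \<in> carrier_mat (\<rho> c - \<rho> (c - 1)) CARD('n)"
      using jac_carrier smooth_vec_onD(1)[OF zeta_block_smooth[OF c j] x] by blast
    then show "dim_vec (jac (\<zeta> c j) x *\<^sub>v w) = dim_vec (0\<^sub>v (\<rho> c - \<rho> (c - 1)) :: real Matrix.vec)"
      by simp
  qed
  have block: "smooth_vec_on U (\<Sum>j\<leftarrow>[1..<Suc c]. \<rho> c - \<rho> (c - 1)) (\<lambda>x. col_vec (map (\<lambda>j. \<zeta> c j x) [1..<Suc c]))"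
    if "c \<in> set [1..<Suc K]" for c
    using that by (intro smooth_vec_on_col_vec U(1) zeta_block_smooth) auto
  show ?thesis
    unfolding Phi_d_def[abs_def] sum_list_block_sizes[symmetric]
  proof (rule iffD2[OF jac_col_vec_kernel[where ks = "[1..<Suc K]"
          and F = "\<lambda>c x. col_vec (map (\<lambda>j. \<zeta> c j x) [1..<Suc c])", OF U(1) x block w]], assumption, intro ballI)
    fix c assume c: "c \<in> set [1..<Suc K]"
    have sm: "smooth_vec_on U (\<rho> c - \<rho> (c - 1)) (\<zeta> c j)" if "j \<in> set [1..<Suc c]" for j
      using that c by (intro zeta_block_smooth) auto
    show "jac (\<lambda>x. col_vec (map (\<lambda>j. \<zeta> c j x) [1..<Suc c])) x *\<^sub>v w
        = 0\<^sub>v (\<Sum>j\<leftarrow>[1..<Suc c]. \<rho> c - \<rho> (c - 1))"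
      by (rule iffD2[OF jac_col_vec_kernel[where ks = "[1..<Suc c]" and F = "\<zeta> c", OF U(1) x sm w]])
        (use zeta0 c in auto)
  qed
qed

lemma local_coordinates:
  assumes x0: "x0 \<in> U" and B: "full_row_rank (jac (Phi_d p \<rho> R S \<Theta> K) x0)"
  shows "\<exists>V (\<eta> :: real^'n \<Rightarrow> real Matrix.vec) (\<Gamma>i :: real^'n \<Rightarrow> real mat)
      (fe :: real^'n \<Rightarrow> real Matrix.vec) (ge :: real^'n \<Rightarrow> real mat) (\<phi> :: real^'n \<Rightarrow> real mat).
    open V \<and> x0 \<in> V \<and> V \<subseteq> U \<and>
    smooth_vec_on V (CARD('n) - n_upto \<rho> K) \<eta> \<and>
    diffeomorphism_on V (\<lambda>x. vec_to_state (\<eta> x @\<^sub>v Xi x) :: real^'n) \<and>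
    smooth_mat_on V m m \<Gamma>i \<and> (\<forall>x\<in>V. invertible_mat (\<Gamma>i x)) \<and>
    smooth_vec_on V (CARD('n) - n_upto \<rho> K) fe \<and>
    smooth_mat_on V (CARD('n) - n_upto \<rho> K) (m - \<rho> K) ge \<and>
    smooth_mat_on V (CARD('n) - n_upto \<rho> K) (\<rho> K) \<phi> \<and>
    (\<forall>x\<in>V. \<forall>u\<in>carrier_vec m. jac \<eta> x *\<^sub>v flow x u =
       fe x + ge x *\<^sub>v vec_first (\<Gamma>i x *\<^sub>v u) (m - \<rho> K) + \<phi> x *\<^sub>v (va x + vb x *\<^sub>v u))"
proof -
  let ?n = "CARD('n)" and ?nd = "n_upto \<rho> K" and ?md = "\<rho> K"
  let ?A = "jac (Phi_d p \<rho> R S \<Theta> K) x0"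
  have A: "?A \<in> carrier_mat ?nd ?n" using jac_carrier smooth_vec_onD(1)[OF Phi_d_smooth x0] by blast
  \<comment> \<open>The rows of \<open>C\<close> become the linear functions \<eta>; they complete
    the Jacobian of \<open>Phi_d\<close> at \<open>x0\<close>.\<close>
  obtain C where C: "C \<in> carrier_mat (?n - ?nd) ?n" and CA: "invertible_mat (C @\<^sub>r ?A)"
    using full_row_rank_completion(2)[OF A B] by blast
  have nd: "?n - ?nd + ?nd = ?n" using full_row_rank_completion(1)[OF A B] by simp
  have vb0: "vb x0 \<in> carrier_mat ?md m" using smooth_mat_onD(1)[OF vb_smooth x0] .
  obtain C' where C': "C' \<in> carrier_mat (m - ?md) m" and Cvb: "invertible_mat (C' @\<^sub>r vb x0)"
    using full_row_rank_completion(2)[OF vb0 vb_full_row_rank[OF x0]] by blast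
  have md: "m - ?md + ?md = m" using full_row_rank_completion(1)[OF vb0 vb_full_row_rank[OF x0]] by simp
  define \<Gamma>i where "\<Gamma>i x = C' @\<^sub>r vb x" for x
  have Gi: "smooth_mat_on U m m \<Gamma>i"
    using smooth_mat_on_append_rows[OF U(1) smooth_mat_on_const[OF C'] vb_smooth] md by (simp add: \<Gamma>i_def[abs_def])
  \<comment> \<open>The constant rows \<open>C'\<close> are fitted at \<open>x0\<close> only.
    Shrinking to \<open>W\<close> first makes the neighbourhood of the inverse function theorem
    serve both transformations.\<close>
  obtain W where W: "open W" "x0 \<in> W" "W \<subseteq> U" "\<And>x. x \<in> W \<Longrightarrow> invertible_mat (\<Gamma>i x)"
    using invertible_mat_open_nbhd[OF U(1) Gi x0] Cvb by (auto simp: \<Gamma>i_def)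
  define \<eta> where "\<eta> x = C *\<^sub>v state_to_vec x" for x :: "real^'n"
  have eta: "smooth_vec_on V (?n - ?nd) \<eta>" if "open V" for V
    unfolding \<eta>_def[abs_def]
    by (rule smooth_vec_on_mult[OF that smooth_mat_on_const[OF C] smooth_vec_on_state_to_vec[OF that]])
  have coord: "smooth_vec_on W ?n (\<lambda>x. \<eta> x @\<^sub>v Xi x)"
    using smooth_vec_on_append[OF W(1) eta[OF W(1)] smooth_vec_on_subset[OF Xi_smooth W(3)]] nd by simp
  \<comment> \<open>A kernel vector of the Jacobian of the coordinates is killed by \<open>C\<close>
    and by the Jacobian of \<open>Phi_d\<close>, hence by their nonsingular stack.\<close>
  have "inj (frechet_derivative (\<lambda>x. vec_to_state (\<eta> x @\<^sub>v Xi x) :: real^'n) (at x0))"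
  proof (rule inj_derivative_vec_to_state[OF W(1,2) coord])
    fix w assume w: "w \<in> carrier_vec ?n" and "jac (\<lambda>x. \<eta> x @\<^sub>v Xi x) x0 *\<^sub>v w = 0\<^sub>v ?n"
    then have "jac \<eta> x0 *\<^sub>v w = 0\<^sub>v (?n - ?nd)" "jac Xi x0 *\<^sub>v w = 0\<^sub>v ?nd"
      using jac_append_kernel[OF U(1) x0 eta[OF U(1)] Xi_smooth w] nd by auto
    then have "C *\<^sub>v w = 0\<^sub>v (?n - ?nd)" "?A *\<^sub>v w = 0\<^sub>v ?nd"
      using jac_linear_coordinates[OF U(1) x0 C w] Phi_d_kernel[OF x0 w] by (simp_all add: \<eta>_def[abs_def])
    then have "(C @\<^sub>r ?A) *\<^sub>v w = 0\<^sub>v ?n"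
      using mat_mult_append[OF C A w] append_vec_eq_zero_iff[of "0\<^sub>v (?n - ?nd)" "?n - ?nd" "0\<^sub>v ?nd" ?nd] nd by simp
    moreover have "C @\<^sub>r ?A \<in> carrier_mat ?n ?n" using carrier_append_rows[OF C A] nd by simp
    ultimately show "w = 0\<^sub>v ?n" using CA invertible_mat_iff_kernel w by blast
  qed
  then obtain V where V: "open V" "x0 \<in> V" "V \<subseteq> W"
    "diffeomorphism_on V (\<lambda>x. vec_to_state (\<eta> x @\<^sub>v Xi x) :: real^'n)"
    using smooth_inverse_function_theorem[OF W(1,2) smooth_on_vec_to_state[OF W(1) coord]] by blast
  have VU: "V \<subseteq> U" using V(3) W(3) by blast
  have GiV: "smooth_mat_on V m m \<Gamma>i" using smooth_mat_on_subset[OF Gi VU] .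
  have inv: "invertible_mat (\<Gamma>i x)" if "x \<in> V" for x using W(4) V(3) that by blast
  obtain Q where Q: "smooth_mat_on V m m Q" and QG: "\<And>x. x \<in> V \<Longrightarrow> Q x * \<Gamma>i x = 1\<^sub>m m"
    using smooth_inverse_mat[OF V(1) GiV inv] by blast
  \<comment> \<open>With \<open>Q x\<close> inverse to \<open>\<Gamma>i x\<close>, this is the input
    coefficient of \<eta> with respect to the transformed input
    \<open>\<Gamma>i x *\<^sub>v u\<close>.\<close>
  define N where "N x = C * g x * Q x" for x
  have Cg: "smooth_mat_on V (?n - ?nd) m (\<lambda>x. C * g x)"
    by (rule smooth_mat_on_mult[OF V(1) smooth_mat_on_const[OF C] smooth_mat_on_subset[OF g VU]])
  have N: "smooth_mat_on V (?n - ?nd) m N"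
    unfolding N_def[abs_def] by (rule smooth_mat_on_mult[OF V(1) Cg Q])
  define ge where "ge x = Matrix.mat (?n - ?nd) (m - ?md) (\<lambda>(i, j). N x $$ (i, j))" for x
  define \<phi> where "\<phi> x = Matrix.mat (?n - ?nd) ?md (\<lambda>(i, j). N x $$ (i, m - ?md + j))" for x
  \<comment> \<open>The lower part of the transformed input is \<open>vb x *\<^sub>v u\<close>; the
    subtracted term allows v to take its place.\<close>
  define fe where "fe x = C *\<^sub>v f x - \<phi> x *\<^sub>v va x" for x
  have ge: "smooth_mat_on V (?n - ?nd) (m - ?md) ge" and phi: "smooth_mat_on V (?n - ?nd) ?md \<phi>"
    using smooth_mat_onD(2)[OF N] md by (auto simp: smooth_mat_on_def ge_def \<phi>_def)
  have fe: "smooth_vec_on V (?n - ?nd) fe"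
    unfolding fe_def[abs_def]
    by (intro smooth_vec_on_diff smooth_vec_on_mult[OF V(1) smooth_mat_on_const[OF C]]
        smooth_vec_on_mult[OF V(1) phi] smooth_vec_on_subset[OF f VU] smooth_vec_on_subset[OF va_smooth VU] V(1))
  have "jac \<eta> x *\<^sub>v flow x u = fe x + ge x *\<^sub>v vec_first (\<Gamma>i x *\<^sub>v u) (m - ?md) + \<phi> x *\<^sub>v (va x + vb x *\<^sub>v u)"
    if x: "x \<in> V" and u: "u \<in> carrier_vec m" for x u
  proof -
    have xU: "x \<in> U" using x VU by blast
    note c = smooth_mat_onD(1)[OF GiV x] smooth_mat_onD(1)[OF Q x] smooth_mat_onD(1)[OF N x]
      smooth_mat_onD(1)[OF ge x] smooth_mat_onD(1)[OF phi x] smooth_mat_onD(1)[OF g xU]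
      smooth_vec_onD(1)[OF f xU] smooth_vec_onD(1)[OF va_smooth xU] smooth_mat_onD(1)[OF vb_smooth xU]
      smooth_mat_onD(1)[OF Cg x]
    let ?ue = "C' *\<^sub>v u" and ?ub = "vb x *\<^sub>v u"
    have ue: "?ue \<in> carrier_vec (m - ?md)" and ub: "?ub \<in> carrier_vec ?md" using C' c(9) u by auto
    have Gu: "\<Gamma>i x *\<^sub>v u = ?ue @\<^sub>v ?ub" unfolding \<Gamma>i_def by (rule mat_mult_append[OF C' c(9) u])
    have first: "vec_first (\<Gamma>i x *\<^sub>v u) (m - ?md) = ?ue"
      unfolding Gu by (rule vec_first_append[OF ue])
    have "C *\<^sub>v (g x *\<^sub>v u) = (C * g x) *\<^sub>v u" using assoc_mult_mat_vec[OF C c(6) u] by simp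
    also have "u = Q x *\<^sub>v (\<Gamma>i x *\<^sub>v u)" using assoc_mult_mat_vec[OF c(2,1) u] QG[OF x] u by simp
    then have "(C * g x) *\<^sub>v u = N x *\<^sub>v (\<Gamma>i x *\<^sub>v u)"
      unfolding N_def using assoc_mult_mat_vec[OF c(10,2) mult_mat_vec_carrier[OF c(1) u]] by simp
    also have "\<dots> = ge x *\<^sub>v ?ue + \<phi> x *\<^sub>v ?ub"
      unfolding Gu ge_def \<phi>_def using c(3) md by (intro mult_mat_vec_split[OF _ ue ub]) simp
    finally have Cgu: "C *\<^sub>v (g x *\<^sub>v u) = ge x *\<^sub>v ?ue + \<phi> x *\<^sub>v ?ub" .
    have "jac \<eta> x *\<^sub>v flow x u = C *\<^sub>v flow x u"
      unfolding \<eta>_def[abs_def] by (rule jac_linear_coordinates[OF U(1) xU C flow_carrier[OF xU u]])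
    also have "\<dots> = C *\<^sub>v f x + C *\<^sub>v (g x *\<^sub>v u)"
      unfolding flow_def by (rule mult_add_distrib_mat_vec[OF C c(7) mult_mat_vec_carrier[OF c(6) u]])
    also have "\<dots> = C *\<^sub>v f x + (ge x *\<^sub>v ?ue + \<phi> x *\<^sub>v ?ub)" unfolding Cgu ..
    also have "\<dots> = fe x + ge x *\<^sub>v ?ue + \<phi> x *\<^sub>v (va x + ?ub)"
      unfolding fe_def mult_add_distrib_mat_vec[OF c(5,8) ub]
      by (rule vec_add_regroup[OF mult_mat_vec_carrier[OF C c(7)] mult_mat_vec_carrier[OF c(4) ue]
            mult_mat_vec_carrier[OF c(5) ub] mult_mat_vec_carrier[OF c(5,8)]])
    finally show ?thesis unfolding first .
  qed
  then show ?thesis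
    using V(1,2,4) VU eta[OF V(1)] GiV inv fe ge phi by blast
qed

end

text \<open>Chains are numbered from 0, but \<open>j\<close> counts from 1 inside a chain, hence the
  entry \<open>j - 1\<close>. The chains, v and the output transformation are defined on all of
  \<open>U\<close>; \<eta> and \<Gamma>i complete them at a given point, and the completion is only
  guaranteed nearby.\<close>

theorem theorem3p2p1:
  fixes U :: "(real^'n) set"
    and f h :: "real^'n \<Rightarrow> real Matrix.vec" and g :: "real^'n \<Rightarrow> real mat"
    and n m p md nd kstar :: nat and q :: "nat list"
    and \<rho> :: "nat \<Rightarrow> nat" and R S :: "nat \<Rightarrow> real mat"
    and P :: "nat \<Rightarrow> nat \<Rightarrow> real^'n \<Rightarrow> real mat" and \<Theta> :: "nat \<Rightarrow> real^'n \<Rightarrow> real Matrix.vec"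
  assumes n: "n = CARD('n)"
    and U: "open U" "0 \<in> U"
    and f: "smooth_vec_on U n f" "f 0 = 0\<^sub>v n"
    and g: "smooth_mat_on U n m g"
    and h: "smooth_vec_on U p h" "h 0 = 0\<^sub>v p"
    and run: "zero_structure_run m p U f g h \<rho> R S P \<Theta> kstar"
    and regular: "regular p U g \<rho> R \<Theta> kstar"
    and B: "\<And>x. x \<in> U \<Longrightarrow> full_row_rank (jac (Phi_d p \<rho> R S \<Theta> kstar) x)"
    and md: "md = \<rho> kstar" and nd: "nd = n_upto \<rho> kstar" and q: "q = q_list \<rho> kstar"
  shows "\<exists>(\<Gamma>o :: real mat) (he :: real^'n \<Rightarrow> real Matrix.vec)
      (\<xi> :: nat \<Rightarrow> real^'n \<Rightarrow> real Matrix.vec) (a :: real^'n \<Rightarrow> real Matrix.vec)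
      (b :: real^'n \<Rightarrow> real mat) (\<delta> :: nat \<Rightarrow> nat \<Rightarrow> nat \<Rightarrow> real^'n \<Rightarrow> real).
    \<Gamma>o \<in> carrier_mat p p \<and> invertible_mat \<Gamma>o \<and>
    smooth_vec_on U (p - md) he \<and>
    (\<forall>i<md. smooth_vec_on U (q ! i) (\<xi> i)) \<and>
    smooth_vec_on U md a \<and> smooth_mat_on U md m b \<and> (\<forall>x\<in>U. full_row_rank (b x)) \<and>
    (\<forall>i<md. \<forall>j\<in>{1..<q ! i}. \<forall>l<i. smooth_on U (\<delta> i j l) \<and>
       (j < q ! l \<longrightarrow> (\<forall>x\<in>U. \<delta> i j l x = 0))) \<and>
    (\<forall>x\<in>U. \<Gamma>o *\<^sub>v h x = he x @\<^sub>v Matrix.vec md (\<lambda>i. \<xi> i x $ 0)) \<and>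
    (\<forall>x\<in>U. \<forall>u\<in>carrier_vec m.
       let xdot = f x + g x *\<^sub>v u; v = a x + b x *\<^sub>v u in
       \<forall>i<md. let \<xi>dot = jac (\<xi> i) x *\<^sub>v xdot in
         (\<forall>j\<in>{1..<q ! i}. \<xi>dot $ (j - 1) = \<xi> i x $ j + (\<Sum>l<i. \<delta> i j l x * v $ l)) \<and>
         \<xi>dot $ (q ! i - 1) = v $ i) \<and>
    (\<forall>x0\<in>U. \<exists>V (\<eta> :: real^'n \<Rightarrow> real Matrix.vec) (\<Gamma>i :: real^'n \<Rightarrow> real mat)
        (fe :: real^'n \<Rightarrow> real Matrix.vec) (ge :: real^'n \<Rightarrow> real mat) (\<phi> :: real^'n \<Rightarrow> real mat).
      open V \<and> x0 \<in> V \<and> V \<subseteq> U \<and>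
      smooth_vec_on V (n - nd) \<eta> \<and>
      diffeomorphism_on V
        (\<lambda>x. vec_to_state (\<eta> x @\<^sub>v col_vec (map (\<lambda>i. \<xi> i x) [0..<md])) :: real^'n) \<and>
      smooth_mat_on V m m \<Gamma>i \<and> (\<forall>x\<in>V. invertible_mat (\<Gamma>i x)) \<and>
      smooth_vec_on V (n - nd) fe \<and> smooth_mat_on V (n - nd) (m - md) ge \<and>
      smooth_mat_on V (n - nd) md \<phi> \<and>
      (\<forall>x\<in>V. \<forall>u\<in>carrier_vec m.
         let xdot = f x + g x *\<^sub>v u; v = a x + b x *\<^sub>v u; ue = vec_first (\<Gamma>i x *\<^sub>v u) (m - md) in
         jac \<eta> x *\<^sub>v xdot = fe x + ge x *\<^sub>v ue + \<phi> x *\<^sub>v v))"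
proof -
  interpret regular_system U f h g m p kstar \<rho> R S P \<Theta>
    using U f g h run regular n by unfold_locales auto
  have dims: "md = \<rho> kstar" "nd = n_upto \<rho> kstar" "q = q_list \<rho> kstar" "n = CARD('n)"
    using md nd q n by auto
  show ?thesis
    unfolding dims Let_def flow_def[symmetric]
  proof (rule exI[of _ Gamma_o], rule exI[of _ h_e], rule exI[of _ xi], rule exI[of _ va],
      rule exI[of _ vb], rule exI[of _ delta], intro conjI allI ballI impI)
    show "Gamma_o \<in> carrier_mat p p" by (rule Gamma_o_carrier)
    show "invertible_mat Gamma_o" by (rule Gamma_o_invertible)
    show "smooth_vec_on U (p - \<rho> kstar) h_e" by (rule h_e_smooth)
    show "smooth_vec_on U (q_list \<rho> kstar ! i) (xi i)" if "i < \<rho> kstar" for i by (rule xi_smooth[OF that])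
    show "smooth_vec_on U (\<rho> kstar) va" by (rule va_smooth)
    show "smooth_mat_on U (\<rho> kstar) m vb" by (rule vb_smooth)
    show "full_row_rank (vb x)" if "x \<in> U" for x by (rule vb_full_row_rank[OF that])
    show "smooth_on U (delta i j l)" if "i < \<rho> kstar" "j \<in> {1..<q_list \<rho> kstar ! i}" for i j l
      by (rule delta_smooth[OF that])
    show "delta i j l x = 0" if "i < \<rho> kstar" "l < i" "j < q_list \<rho> kstar ! l" for i j l x
      using delta_eq_0[of l j] that by simp
    show "Gamma_o *\<^sub>v h x = h_e x @\<^sub>v Matrix.vec (\<rho> kstar) (\<lambda>i. xi i x $ 0)" if "x \<in> U" for x
      by (rule output_transformation[OF that])
    show "(jac (xi i) x *\<^sub>v flow x u) $ (j - 1) = xi i x $ j + (\<Sum>l<i. delta i j l x * (va x + vb x *\<^sub>v u) $ l)"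
      if "x \<in> U" "u \<in> carrier_vec m" "i < \<rho> kstar" "j \<in> {1..<q_list \<rho> kstar ! i}" for x u i j
      using xi_dynamics(1) that by blast
    show "(jac (xi i) x *\<^sub>v flow x u) $ (q_list \<rho> kstar ! i - 1) = (va x + vb x *\<^sub>v u) $ i"
      if "x \<in> U" "u \<in> carrier_vec m" "i < \<rho> kstar" for x u i
      using xi_dynamics(2) that by blast
  qed (rule local_coordinates[OF _ B])
qed

end
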